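(* Consider the inventory dynamics $\dot x(t) = B\lambda(t) + Pw(t)$ with the supply/demand generated by the dynamical system $\dot w(t) = s(w(t))$, $w(0)=w_0$. Suppose that: (A1) there is a compact set $\mathcal{W}\subset\mathbb{R}^r$ that is forward invariant under $\dot w = s(w)$, and $w(0)\in\mathcal{W}$; (A2) $\mathbf{1}_n^T P w(t) = 0$ for all $t\ge 0$; (A4) the cost functions $\mathcal{P}_1,\dots,\mathcal{P}_m$ are of Legendre type in the sense given in the context; (A5) for every nonempty proper subset $S\subset V$ the capacity of the cut induced by $S$ is infinite, $\bar\lambda_{Q(S)}=\infty$. Then, for every scalar controller gain $k>0$, the dynamic controller $$\dot\zeta = -\,\Pi\,\Xi(\zeta)\Bigl(Ps(w) + x + k\bigl(B\nabla\mathcal{P}^{-1}(B^T\zeta) + Pw\bigr)\Bigr),\qquad \lambda = \nabla\mathcal{P}^{-1}(B^T\zeta) - B^T x,$$ with $\Pi = I_n-\frac1n\mathbf{1}_n\mathbf{1}_n^T$ and $\Xi(\zeta)$ as defined in the context, solves the time-varying optimal distribution problem for any initial inventory levels $x(0)\in\mathbb{R}^n$ and any controller initialization $\zeta(0)\in\mathbb{R}^n$; that is, every trajectory $(x(t),w(t),\zeta(t))$ of the closed-loop system is bounded, and (i) $\lim_{t\to\infty} B^T x(t) = 0$; (ii) $\lim_{t\to\infty} \mathrm{dist}_{\Gamma}\bigl(\lambda(t),w(t)\bigr) = 0$.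
   Context: **Network.** $\mathcal{G}=(V,E)$ is a graph with $|V|=n$ nodes (inventories) and $|E|=m$ edges (transportation lines) with an arbitrary fixed orientation. $B\in\mathbb{R}^{n\times m}$ is its incidence matrix: $[B]_{ik}=+1$ if node $i$ is the initial node of edge $k$, $-1$ if it is the terminal node, $0$ otherwise. $\mathbf{1}_n$ is the all-ones vector in $\mathbb{R}^n$, $\mathcal{R}(\cdot)$ denotes the range of a matrix, and $(BB^T)^\dagger$ is the (Moore–Penrose) generalized inverse of $BB^T$. **Inventory system.** $x\in\mathbb{R}^n$ is the storage level, $\lambda\in\mathbb{R}^m$ the flow along the lines, $P\in\mathbb{R}^{n\times r}$ a given matrix, and $w\in\mathbb{R}^r$ the state of the exo-system $\dot w=s(w)$, where $s:\mathbb{R}^r\to\mathbb{R}^r$ is a given vector field. Solutions $w(t)$ starting in $\mathcal{W}$ are understood to be continuously differentiable and defined for all $t\ge0$. **Capacities and cuts.** Each line $k$ has a capacity $\bar\lambda_k\in(0,\infty]$ ($\bar\lambda_k=\infty$ if line $k$ is unconstrained). For $S\subseteq V$, the cut $Q(S)$ induced by $S$ is the set of all edges having exactly one endpoint in $S$, and its capacity is $\bar\lambda_{Q(S)}=\sum_{k\in Q(S)}\bar\lambda_k$. **Cost functions (Legendre type).** For each $k$, $\mathcal{P}_k$ is a convex function with $\mathcal{P}_k(\lambda_k)=\infty$ for $|\lambda_k|>\bar\lambda_k$; it is $C^\infty$ and strictly convex on the open interval $(-\bar\lambda_k,\bar\lambda_k)$, and $\lim_{\ell\to\infty}|\nabla\mathcal{P}_k(\lambda_k^{[\ell]})|=+\infty$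 for every sequence with $|\lambda_k^{[\ell]}|<\bar\lambda_k$ and $\lim_{\ell\to\infty}|\lambda_k^{[\ell]}|=\bar\lambda_k$. Hence $\nabla\mathcal{P}_k$ is invertible on $(-\bar\lambda_k,\bar\lambda_k)$, with inverse $\nabla\mathcal{P}_k^{-1}:\mathbb{R}\to(-\bar\lambda_k,\bar\lambda_k)$. It is also assumed that the derivative of $\nabla\mathcal{P}_k^{-1}$, denoted $\nabla^2\mathcal{P}_k^{-1}$, exists, is strictly positive and is continuously differentiable. Write $\mathcal{P}(\lambda)=\sum_{k=1}^m\mathcal{P}_k(\lambda_k)$, $\nabla\mathcal{P}^{-1}(z)=(\nabla\mathcal{P}_1^{-1}(z_1),\dots,\nabla\mathcal{P}_m^{-1}(z_m))^T$ and $\mathrm{D}\mathcal{P}^{-1}(z)=\mathrm{diag}[\nabla^2\mathcal{P}_1^{-1}(z_1),\dots,\nabla^2\mathcal{P}_m^{-1}(z_m)]$ for $z\in\mathbb{R}^m$. **Optimal routing set.** $$\Gamma=\{(\lambda,w)\in\mathbb{R}^m\times\mathcal{W}\,:\,\nabla\mathcal{P}(\lambda)\in\mathcal{R}(B^T),\ B\lambda+Pw=0\},$$ where $\lambda$ ranges over points with $|\lambda_k|<\bar\lambda_k$ for all $k$, so that $\nabla\mathcal{P}(\lambda)$ is defined. ($(\lambda,w)\in\Gamma$ means that $\lambda$ minimizes $\mathcal{P}$ subject to $B\lambda+Pw=0$.) $\mathrm{dist}_{\mathcal{A}}(q)=\inf_{p\in\mathcal{A}}\|p-q\|$. **Time-varying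 optimal distribution problem.** It is solved by a controller $\dot\zeta=\Phi(\zeta,w,x)$, $\lambda=\Psi(\zeta,x)$ if every solution $(x(t),w(t),\zeta(t))$ of the closed-loop system is bounded and satisfies (i) $\lim_{t\to\infty}B^Tx(t)=0$ and (ii) $\lim_{t\to\infty}\mathrm{dist}_\Gamma(\lambda(t),w(t))=0$. **The matrices $X(\zeta)$ and $\Xi(\zeta)$.** For $\zeta\in\mathbb{R}^n$ let $H(\zeta)=\mathrm{D}\mathcal{P}^{-1}(B^T\zeta)$, a diagonal matrix with positive diagonal entries $h_1(\zeta),\dots,h_m(\zeta)$. For a spanning tree $\mathcal{T}=(V,T)$ of $\mathcal{G}$ put $h(\mathcal{T})=\prod_{l\in T}h_l(\zeta)$, and let $\bar h=\sum_{\mathcal{T}}h(\mathcal{T})$, the sum over all spanning trees. For $k\in T$, removing $k$ from $\mathcal{T}$ leaves two connected components; $U(\mathcal{T},k)$ denotes the node set of the component containing the positive end of $k$, i.e. the node $i$ with $[B]_{ik}=+1$. The matrix $X(\zeta)\in\mathbb{R}^{m\times n}$ has entries $$[X(\zeta)]_{ki}=\frac{1}{\bar h}\sum_{\{\mathcal{T}=(V,T)\,:\,k\in T,\ i\in U(\mathcal{T},k)\}}h(\mathcal{T}),$$ and $$\Xi(\zeta)=X(\zeta)^T\,H(\zeta)^{-1}\,B^T(BB^T)^\dagger\in\mathbb{R}^{n\times n}.$$ *)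

theory Defs
  imports "HOL-Analysis.Analysis"
begin

text \<open>
  A network with node type \<open>'n\<close> and edge type \<open>'m\<close> is given by the two end-node maps
  \<open>src\<close> (initial node, the positive end) and \<open>tgt\<close> (terminal node) of the chosen orientation.
  In \<open>real ^ 'm ^ 'n\<close> the outer index \<open>'n\<close> counts the rows.
\<close>

definition incidence :: "('m::finite \<Rightarrow> 'n::finite) \<Rightarrow> ('m \<Rightarrow> 'n) \<Rightarrow> real ^ 'm ^ 'n" where
  "incidence src tgt = (\<chi> i k. if i = src k then 1 else if i = tgt k then -1 else 0)"

definition cut :: "('m \<Rightarrow> 'n) \<Rightarrow> ('m \<Rightarrow> 'n) \<Rightarrow> 'n set \<Rightarrow> 'm set" where
  "cut src tgt S = {k. (src k \<in> S) \<noteq> (tgt k \<in> S)}"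

definition cut_capacity :: "('m::finite \<Rightarrow> 'n) \<Rightarrow> ('m \<Rightarrow> 'n) \<Rightarrow> ('m \<Rightarrow> ereal) \<Rightarrow> 'n set \<Rightarrow> ereal" where
  "cut_capacity src tgt cap S = (\<Sum>k\<in>cut src tgt S. cap k)"

definition adjacent :: "('m \<Rightarrow> 'n) \<Rightarrow> ('m \<Rightarrow> 'n) \<Rightarrow> 'm set \<Rightarrow> ('n \<times> 'n) set" where
  "adjacent src tgt T = {(i, j). \<exists>k\<in>T. (src k = i \<and> tgt k = j) \<or> (src k = j \<and> tgt k = i)}"

definition has_cycle :: "('m \<Rightarrow> 'n) \<Rightarrow> ('m \<Rightarrow> 'n) \<Rightarrow> 'm set \<Rightarrow> bool" where
  "has_cycle src tgt T \<longleftrightarrow>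
     (\<exists>vs es. es \<noteq> [] \<and> length vs = length es \<and> distinct vs \<and> distinct es \<and> set es \<subseteq> T \<and>
        (\<forall>i<length es. {src (es ! i), tgt (es ! i)} = {vs ! i, vs ! (Suc i mod length es)}))"

text \<open>
  Trees are meant in the undirected graph.  The notion of tree in the AFP entry \<open>Graph_Theory\<close>
  excludes directed cycles only, so it would not do here.
\<close>

definition spanning_tree :: "('m \<Rightarrow> 'n) \<Rightarrow> ('m \<Rightarrow> 'n) \<Rightarrow> 'm set \<Rightarrow> bool" where
  "spanning_tree src tgt T \<longleftrightarrow>
     (\<forall>i j. (i, j) \<in> (adjacent src tgt T)\<^sup>*) \<and> \<not> has_cycle src tgt T"

definition tree_component :: "('m \<Rightarrow> 'n) \<Rightarrow> ('m \<Rightarrow> 'n) \<Rightarrow> 'm set \<Rightarrow> 'm \<Rightarrow> 'n set" where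
  "tree_component src tgt T k = {i. (src k, i) \<in> (adjacent src tgt (T - {k}))\<^sup>*}"

definition capacity_interval :: "ereal \<Rightarrow> real set" where
  "capacity_interval c = {l. ereal \<bar>l\<bar> < c}"

definition convex_extended :: "(real \<Rightarrow> ereal) \<Rightarrow> bool" where
  "convex_extended f \<longleftrightarrow>
     (\<forall>l. f l \<noteq> -\<infinity>) \<and>
     (\<forall>x y u. 0 < u \<and> u < 1 \<longrightarrow>
        f ((1 - u) * x + u * y) \<le> ereal (1 - u) * f x + ereal u * f y)"

definition strictly_convex_on :: "real set \<Rightarrow> (real \<Rightarrow> real) \<Rightarrow> bool" where
  "strictly_convex_on I f \<longleftrightarrow>
     convex I \<and>
     (\<forall>x\<in>I. \<forall>y\<in>I. \<forall>u. x \<noteq> y \<and> 0 < u \<and> u < 1 \<longrightarrow>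
        f ((1 - u) * x + u * y) < (1 - u) * f x + u * f y)"

text \<open>Only meaningful for open \<open>I\<close>, where \<open>deriv\<close> at points of \<open>I\<close> depends on \<open>f\<close> on \<open>I\<close> only.\<close>

definition smooth_on_open :: "real set \<Rightarrow> (real \<Rightarrow> real) \<Rightarrow> bool" where
  "smooth_on_open I f \<longleftrightarrow> (\<forall>n. \<forall>l\<in>I. ((deriv ^^ n) f) field_differentiable (at l))"

definition marginal_cost :: "(real \<Rightarrow> ereal) \<Rightarrow> real \<Rightarrow> real" where
  "marginal_cost f = deriv (\<lambda>l. real_of_ereal (f l))"

definition marginal_cost_inv :: "ereal \<Rightarrow> (real \<Rightarrow> ereal) \<Rightarrow> real \<Rightarrow> real" where
  "marginal_cost_inv c f = inv_into (capacity_interval c) (marginal_cost f)"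

definition legendre_type :: "ereal \<Rightarrow> (real \<Rightarrow> ereal) \<Rightarrow> bool" where
  "legendre_type c f \<longleftrightarrow>
     convex_extended f \<and>
     (\<forall>l. ereal \<bar>l\<bar> > c \<longrightarrow> f l = \<infinity>) \<and>
     (\<forall>l\<in>capacity_interval c. f l \<noteq> \<infinity>) \<and>
     smooth_on_open (capacity_interval c) (\<lambda>l. real_of_ereal (f l)) \<and>
     strictly_convex_on (capacity_interval c) (\<lambda>l. real_of_ereal (f l)) \<and>
     (\<forall>l :: nat \<Rightarrow> real.
        (\<forall>i. ereal \<bar>l i\<bar> < c) \<and> (\<lambda>i. ereal \<bar>l i\<bar>) \<longlonglongrightarrow> c \<longrightarrow>
        filterlim (\<lambda>i. \<bar>marginal_cost f (l i)\<bar>) at_top sequentially) \<and>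
     (\<forall>z. marginal_cost_inv c f field_differentiable (at z)) \<and>
     (\<forall>z. deriv (marginal_cost_inv c f) z > 0) \<and>
     deriv (marginal_cost_inv c f) C1_differentiable_on UNIV"

definition grad_cost :: "('m::finite \<Rightarrow> real \<Rightarrow> ereal) \<Rightarrow> real ^ 'm \<Rightarrow> real ^ 'm" where
  "grad_cost cost l = (\<chi> k. marginal_cost (cost k) (l $ k))"

definition grad_cost_inv ::
    "('m::finite \<Rightarrow> ereal) \<Rightarrow> ('m \<Rightarrow> real \<Rightarrow> ereal) \<Rightarrow> real ^ 'm \<Rightarrow> real ^ 'm" where
  "grad_cost_inv cap cost z = (\<chi> k. marginal_cost_inv (cap k) (cost k) (z $ k))"

definition D_grad_cost_inv ::
    "('m::finite \<Rightarrow> ereal) \<Rightarrow> ('m \<Rightarrow> real \<Rightarrow> ereal) \<Rightarrow> real ^ 'm \<Rightarrow> real ^ 'm ^ 'm" where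
  "D_grad_cost_inv cap cost z =
     (\<chi> k l. if k = l then deriv (marginal_cost_inv (cap k) (cost k)) (z $ k) else 0)"

text \<open>The Moore--Penrose inverse, characterized by the four Penrose equations.\<close>

definition pseudo_inverse :: "real ^ 'b ^ 'a \<Rightarrow> real ^ 'a ^ 'b" where
  "pseudo_inverse A =
     (THE Y. A ** Y ** A = A \<and> Y ** A ** Y = Y \<and>
             transpose (A ** Y) = A ** Y \<and> transpose (Y ** A) = Y ** A)"

definition centering :: "real ^ 'n ^ 'n" where
  "centering = mat 1 - (1 / real CARD('n)) *\<^sub>R (\<chi> i j. 1)"

definition H_matrix ::
    "('m::finite \<Rightarrow> 'n::finite) \<Rightarrow> ('m \<Rightarrow> 'n) \<Rightarrow> ('m \<Rightarrow> ereal) \<Rightarrow> ('m \<Rightarrow> real \<Rightarrow> ereal) \<Rightarrow>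
     real ^ 'n \<Rightarrow> real ^ 'm ^ 'm" where
  "H_matrix src tgt cap cost \<zeta> =
     D_grad_cost_inv cap cost (transpose (incidence src tgt) *v \<zeta>)"

definition tree_weight :: "real ^ 'm ^ 'm \<Rightarrow> 'm set \<Rightarrow> real" where
  "tree_weight H T = (\<Prod>l\<in>T. H $ l $ l)"

definition X_matrix ::
    "('m::finite \<Rightarrow> 'n::finite) \<Rightarrow> ('m \<Rightarrow> 'n) \<Rightarrow> ('m \<Rightarrow> ereal) \<Rightarrow> ('m \<Rightarrow> real \<Rightarrow> ereal) \<Rightarrow>
     real ^ 'n \<Rightarrow> real ^ 'n ^ 'm" where
  "X_matrix src tgt cap cost \<zeta> =
     (let H = H_matrix src tgt cap cost \<zeta>;
          h_bar = (\<Sum>T | spanning_tree src tgt T. tree_weight H T)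
      in \<chi> k i. 1 / h_bar *
           (\<Sum>T | spanning_tree src tgt T \<and> k \<in> T \<and> i \<in> tree_component src tgt T k.
              tree_weight H T))"

definition Xi_matrix ::
    "('m::finite \<Rightarrow> 'n::finite) \<Rightarrow> ('m \<Rightarrow> 'n) \<Rightarrow> ('m \<Rightarrow> ereal) \<Rightarrow> ('m \<Rightarrow> real \<Rightarrow> ereal) \<Rightarrow>
     real ^ 'n \<Rightarrow> real ^ 'n ^ 'n" where
  "Xi_matrix src tgt cap cost \<zeta> =
     (let B = incidence src tgt
      in transpose (X_matrix src tgt cap cost \<zeta>)
           ** matrix_inv (H_matrix src tgt cap cost \<zeta>)
           ** transpose B ** pseudo_inverse (B ** transpose B))"

definition exo_solution :: "('a::real_normed_vector \<Rightarrow> 'a) \<Rightarrow> (real \<Rightarrow> 'a) \<Rightarrow> bool" where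
  "exo_solution s w \<longleftrightarrow>
     (\<forall>t\<ge>0. (w has_vector_derivative s (w t)) (at t within {0..})) \<and>
     continuous_on {0..} (\<lambda>t. s (w t))"

definition forward_invariant :: "('a::real_normed_vector \<Rightarrow> 'a) \<Rightarrow> 'a set \<Rightarrow> bool" where
  "forward_invariant s W \<longleftrightarrow>
     (\<forall>w. exo_solution s w \<and> w 0 \<in> W \<longrightarrow> (\<forall>t\<ge>0. w t \<in> W))"

definition optimal_routing_set ::
    "real ^ 'm ^ 'n \<Rightarrow> real ^ 'r ^ 'n \<Rightarrow> (real ^ 'r) set \<Rightarrow> ('m::finite \<Rightarrow> ereal) \<Rightarrow>
     ('m \<Rightarrow> real \<Rightarrow> ereal) \<Rightarrow> ((real ^ 'm) \<times> (real ^ 'r)) set" where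
  "optimal_routing_set B P W cap cost =
     {(l, w). w \<in> W \<and> (\<forall>k. l $ k \<in> capacity_interval (cap k)) \<and>
        grad_cost cost l \<in> range ((*v) (transpose B)) \<and> B *v l + P *v w = 0}"

text \<open>
  Taken in \<open>ereal\<close>, so that the distance to the empty set is \<open>\<infinity>\<close>
  (\<open>infdist\<close> would make it \<open>0\<close>).
\<close>

definition dist_to :: "'a::real_normed_vector set \<Rightarrow> 'a \<Rightarrow> ereal" where
  "dist_to A q = (INF p\<in>A. ereal (norm (p - q)))"

definition time_interval :: "ereal \<Rightarrow> real set" where
  "time_interval \<tau> = {t. 0 \<le> t \<and> ereal t < \<tau>}"

definition closed_loop_trajectory ::
    "real ^ 'm ^ 'n \<Rightarrow> real ^ 'r ^ 'n \<Rightarrow> (real \<Rightarrow> real ^ 'r) \<Rightarrow>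
     ('z::real_normed_vector \<Rightarrow> real ^ 'r \<Rightarrow> real ^ 'n \<Rightarrow> 'z) \<Rightarrow> ('z \<Rightarrow> real ^ 'n \<Rightarrow> real ^ 'm) \<Rightarrow>
     ereal \<Rightarrow> (real \<Rightarrow> real ^ 'n) \<Rightarrow> (real \<Rightarrow> 'z) \<Rightarrow> bool" where
  "closed_loop_trajectory B P w \<Phi> \<Psi> \<tau> x \<zeta> \<longleftrightarrow>
     (\<forall>t\<in>time_interval \<tau>.
        (x has_vector_derivative (B *v \<Psi> (\<zeta> t) (x t) + P *v w t)) (at t within time_interval \<tau>) \<and>
        (\<zeta> has_vector_derivative \<Phi> (\<zeta> t) (w t) (x t)) (at t within time_interval \<tau>))"

text \<open>
  Boundedness is required of the solutions on every interval \<open>[0, \<tau>)\<close> with \<open>0 < \<tau> \<le> \<infinity>\<close>, so that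
  finite escape time is excluded rather than assumed away; the limits concern \<open>\<tau> = \<infinity>\<close>.
\<close>

definition solves_distribution_problem ::
    "real ^ 'm ^ 'n \<Rightarrow> real ^ 'r ^ 'n \<Rightarrow> ((real ^ 'm) \<times> (real ^ 'r)) set \<Rightarrow> (real \<Rightarrow> real ^ 'r) \<Rightarrow>
     ('z::real_normed_vector \<Rightarrow> real ^ 'r \<Rightarrow> real ^ 'n \<Rightarrow> 'z) \<Rightarrow> ('z \<Rightarrow> real ^ 'n \<Rightarrow> real ^ 'm) \<Rightarrow> bool"
  where
  "solves_distribution_problem B P \<Gamma> w \<Phi> \<Psi> \<longleftrightarrow>
     (\<forall>\<tau>>0. \<forall>x \<zeta>. closed_loop_trajectory B P w \<Phi> \<Psi> \<tau> x \<zeta> \<longrightarrow>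
        bounded (x ` time_interval \<tau>) \<and> bounded (w ` time_interval \<tau>) \<and>
        bounded (\<zeta> ` time_interval \<tau>)) \<and>
     (\<forall>x \<zeta>. closed_loop_trajectory B P w \<Phi> \<Psi> \<infinity> x \<zeta> \<longrightarrow>
        ((\<lambda>t. transpose B *v x t) \<longlongrightarrow> 0) at_top \<and>
        ((\<lambda>t. dist_to \<Gamma> (\<Psi> (\<zeta> t) (x t), w t)) \<longlongrightarrow> 0) at_top)"

end

theory Submission
  imports Defs
begin

text \<open>
  Write \<open>B\<close> for the incidence matrix, \<open>p\<close> for the centred inventory levels (the levels minus their mean),
  and \<open>y = B \<nabla>P\<^sup>-\<^sup>1 (B\<^sup>T \<zeta>) + P w\<close> for the imbalance of the flow that the controller state prescribes.
  The proof is that, in these variables, the closed loop is linear with constant coefficients.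

  By the chain rule \<open>y' = B H B\<^sup>T \<zeta>' + P s(w)\<close>, where \<open>H\<close> depends on \<open>\<zeta>\<close>.  The matrix \<open>\<Xi>\<close> inverts
  \<open>B H B\<^sup>T\<close> on balanced vectors (\<open>Xi_matrix_inverts\<close>).  This rests on Kirchhoff's theorem: \<open>X\<close>, which routes a
  supply along a random spanning tree drawn with probability proportional to the product of the
  conductances in \<open>H\<close>, yields on average the electrical current
  (\<open>tree_average_reproduces_currents\<close>).  Its proof counts pairs of a tree and an edge in two ways, by
  exchanging one edge of the tree (\<open>tree_exchange\<close>, \<open>tree_exchange_sum\<close>) and then applying the voltage law
  inside a tree (\<open>tree_path_sum\<close>).  Consequently
  \<open>p' = y - B B\<^sup>T p\<close> and \<open>y' = - p - k y\<close>.
  The derivative of \<open>\<bar>p\<bar>\<^sup>2 + \<bar>y\<bar>\<^sup>2\<close> is \<open>- 2 \<bar>B\<^sup>T p\<bar>\<^sup>2 - 2 k \<bar>y\<bar>\<^sup>2\<close>, and the network is connected, so \<open>p\<close> and \<open>y\<close>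
  decay exponentially (\<open>poincare_inequality\<close>, \<open>energy_decay\<close>).  In particular \<open>B\<^sup>T x = B\<^sup>T p\<close> tends to \<open>0\<close>.

  The controller state has constant mean, and \<open>B \<nabla>P\<^sup>-\<^sup>1 (B\<^sup>T \<zeta>) = y - P w\<close> is bounded.  The cut condition says
  that the edges without capacity bound connect all nodes.  On these edges the inverse marginal costs
  are monotone and unbounded in both directions, so large potential differences would cause a large
  imbalance; hence \<open>\<zeta>\<close> is bounded (\<open>potentials_bounded\<close>).  Finally, at a limit point of the centred
  potentials and the demand the imbalance is zero, which makes the prescribed flow optimal for that
  demand; by compactness the actual routing approaches the optimal set (\<open>routing_converges\<close>).
\<close>

(* Transposes are kept as matrices, so that adjoints can be moved across inner products. *)
declare transpose_matrix_vector [simp del]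

section \<open>Spanning trees and fundamental cuts\<close>

locale network =
  fixes src tgt :: "'m::finite \<Rightarrow> 'n::finite"
  assumes no_loops: "src e \<noteq> tgt e"
begin

definition joined :: "'m set \<Rightarrow> 'n \<Rightarrow> 'n \<Rightarrow> bool" where
  "joined T i j \<longleftrightarrow> (i, j) \<in> (adjacent src tgt T)\<^sup>*"

lemma joined_refl [simp]: "joined T i i"
  by (simp add: joined_def)

lemma joined_trans: "joined T i j \<Longrightarrow> joined T j l \<Longrightarrow> joined T i l"
  unfolding joined_def by (rule rtrancl_trans)

lemma joined_sym: "joined T i j \<Longrightarrow> joined T j i"
proof -
  have "sym (adjacent src tgt T)"
    by (auto simp: adjacent_def sym_def)
  then show "joined T i j \<Longrightarrow> joined T j i"
    unfolding joined_def by (meson sym_rtrancl symD)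
qed

text \<open>
  Being joined is equality of components (\<open>joined_iff_component_eq\<close>), so chains of symmetry and
  transitivity steps become chains of equations.
\<close>

definition component :: "'m set \<Rightarrow> 'n \<Rightarrow> 'n set" where
  "component T i = {j. joined T i j}"

lemma joined_iff_component_eq: "joined T i j \<longleftrightarrow> component T i = component T j"
proof
  assume "joined T i j"
  from joined_trans[OF this] joined_trans[OF joined_sym[OF this]]
  show "component T i = component T j"
    unfolding component_def by blast
next
  assume "component T i = component T j"
  moreover have "j \<in> component T j" by (simp add: component_def)
  ultimately show "joined T i j" by (auto simp: component_def)
qed

lemma joined_mono: "joined T i j \<Longrightarrow> T \<subseteq> T' \<Longrightarrow> joined T' i j"
  unfolding joined_def by (rule rev_subsetD[OF _ rtrancl_mono]) (auto simp: adjacent_def)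

lemma joined_edge: "e \<in> T \<Longrightarrow> joined T (src e) (tgt e)"
  unfolding joined_def by (rule r_into_rtrancl) (auto simp: adjacent_def)

lemma joined_imp_eq:
  assumes "joined T i j" and "\<And>e. e \<in> T \<Longrightarrow> f (src e) = f (tgt e)"
  shows "f i = f j"
  using assms(1) unfolding joined_def by induction (auto simp: adjacent_def assms(2))

lemma joined_induct [consumes 1, case_names base step]:
  assumes "joined T a b" and "Q a"
    and "\<And>b c. joined T a b \<Longrightarrow> (b, c) \<in> adjacent src tgt T \<Longrightarrow> Q b \<Longrightarrow> Q c"
  shows "Q b"
  using assms(1) unfolding joined_def
proof (induction rule: rtrancl_induct)
  case base
  show ?case by (rule assms(2))
next
  case (step b c)
  then show ?case by (intro assms(3)[of b c]) (simp_all add: joined_def)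
qed

text \<open>
  A walk that uses the new edge \<open>l\<close> can be cut short so that it uses \<open>l\<close> once, in one of the two
  directions.
\<close>

lemma joined_insert:
  assumes "joined (insert l A) a b"
  shows "joined A a b \<or> joined A a (src l) \<and> joined A (tgt l) b \<or>
    joined A a (tgt l) \<and> joined A (src l) b"
  using assms
proof (induction rule: joined_induct)
  case base
  then show ?case by simp
next
  case (step b c)
  from step.hyps(2) obtain e where e: "e \<in> insert l A"
    "src e = b \<and> tgt e = c \<or> src e = c \<and> tgt e = b"
    by (auto simp: adjacent_def)
  show ?case
  proof (cases "e \<in> A")
    case True
    then have "joined A b c"
      using e(2) joined_edge joined_sym by metis
    then show ?thesis
      using step.IH joined_trans[of A _ b c] by blast
  next
    case False
    then have "e = l" using e(1) by simp
    then show ?thesis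
      using e(2) step.IH by auto
  qed
qed

text \<open>
  A shortest detour around \<open>k\<close> repeats no node; closing it with \<open>k\<close> gives a cycle.
\<close>

lemma cycle_if_bypassed_edge:
  assumes k: "k \<in> T" and join: "joined (T - {k}) (src k) (tgt k)"
  shows "has_cycle src tgt T"
proof -
  let ?R = "adjacent src tgt (T - {k})"
  define n where "n = (LEAST n. (src k, tgt k) \<in> ?R ^^ n)"
  have "\<exists>n. (src k, tgt k) \<in> ?R ^^ n"
    using join rtrancl_imp_relpow unfolding joined_def by blast
  then have n: "(src k, tgt k) \<in> ?R ^^ n"
    unfolding n_def by (rule LeastI_ex)
  have n_least: "n \<le> p" if "(src k, tgt k) \<in> ?R ^^ p" for p
    unfolding n_def using that by (rule Least_le)
  from n obtain f where f: "f 0 = src k" "f n = tgt k"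
    and step: "\<And>i. i < n \<Longrightarrow> (f i, f (Suc i)) \<in> ?R"
    unfolding relpow_fun_conv by blast
  \<comment> \<open>A repeated node would allow the walk to be shortened.\<close>
  have no_repeat: "f i \<noteq> f j" if ij: "i < j" "j \<le> n" for i j
  proof
    assume eq: "f i = f j"
    have "(src k, f i) \<in> ?R ^^ i"
      unfolding relpow_fun_conv using f(1) step ij by (intro exI[of _ f]) auto
    moreover have "(f j, tgt k) \<in> ?R ^^ (n - j)"
      unfolding relpow_fun_conv using f(2) step ij
      by (intro exI[of _ "\<lambda>p. f (j + p)"]) auto
    ultimately have "(src k, tgt k) \<in> ?R ^^ (i + (n - j))"
      unfolding relpow_add eq by blast
    from n_least[OF this] ij show False by linarith
  qed
  then have f_inj: "f i = f j \<longleftrightarrow> i = j" if "i \<le> n" "j \<le> n" for i j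
    using that by (metis linorder_neqE_nat)
  have "\<exists>e. i < n \<longrightarrow> e \<in> T - {k} \<and> {src e, tgt e} = {f i, f (Suc i)}" for i
    using step[of i] unfolding adjacent_def by (cases "i < n") auto
  then obtain e where e: "\<And>i. i < n \<Longrightarrow> e i \<in> T - {k}"
    "\<And>i. i < n \<Longrightarrow> {src (e i), tgt (e i)} = {f i, f (Suc i)}"
    by metis
  have e_inj: "e i \<noteq> e j" if "i < j" "j < n" for i j
  proof
    assume "e i = e j"
    then have "{f i, f (Suc i)} = {f j, f (Suc j)}"
      using e(2)[of i] e(2)[of j] that by auto
    then have "f i = f j \<or> f i = f (Suc j)" by blast
    then show False using f_inj that by auto
  qed
  \<comment> \<open>The edge \<open>k\<close> comes last, so that the index arithmetic modulo the length wraps around at it.\<close>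
  define vs where "vs = map f [0..<Suc n]"
  define es where "es = map e [0..<n] @ [k]"
  have "distinct vs"
    unfolding vs_def distinct_map by (auto simp: inj_on_def f_inj)
  moreover have "distinct es"
  proof -
    have "inj_on e {0..<n}"
      unfolding inj_on_def using e_inj by (metis atLeastLessThan_iff linorder_neqE_nat)
    moreover have "e i \<noteq> k" if "i < n" for i using e(1)[OF that] by blast
    then have "k \<notin> e ` {0..<n}" by (metis imageE atLeastLessThan_iff)
    ultimately show ?thesis unfolding es_def distinct_append distinct_map by simp
  qed
  moreover have "set es \<subseteq> T"
    unfolding es_def using e(1) k by auto
  moreover have "{src (es ! i), tgt (es ! i)} = {vs ! i, vs ! (Suc i mod length es)}"
    if "i < length es" for i
  proof (cases "i < n")
    case True
    then show ?thesis
      using e(2)[of i] unfolding es_def vs_def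
      by (simp add: nth_append del: upt_Suc)
  next
    case False
    then have "i = n" using that by (simp add: es_def)
    then show ?thesis
      using f unfolding es_def vs_def by (auto simp add: nth_append simp del: upt_Suc)
  qed
  moreover have "es \<noteq> []" "length vs = length es"
    by (auto simp: es_def vs_def)
  ultimately show ?thesis
    unfolding has_cycle_def by blast
qed

text \<open>
  The edges of a cycle other than its last one are a detour around the last one.
\<close>

lemma bypassed_edge_if_cycle:
  assumes "has_cycle src tgt T"
  shows "\<exists>k\<in>T. joined (T - {k}) (src k) (tgt k)"
proof -
  from assms obtain vs es where c: "es \<noteq> []" "length vs = length es" "distinct es" "set es \<subseteq> T"
    and ends: "\<And>i. i < length es \<Longrightarrow>
      {src (es ! i), tgt (es ! i)} = {vs ! i, vs ! (Suc i mod length es)}"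
    unfolding has_cycle_def by blast
  define m where "m = length es - 1"
  have m: "length es = Suc m" using c(1) by (simp add: m_def)
  define k where "k = es ! m"
  have "joined (T - {k}) (vs ! 0) (vs ! i)" if "i \<le> m" for i
    using that
  proof (induction i)
    case 0
    then show ?case by simp
  next
    case (Suc i)
    have "es ! i \<in> T - {k}"
      using c(3,4) Suc.prems m unfolding k_def by (auto simp: nth_eq_iff_index_eq)
    then have "(vs ! i, vs ! Suc i) \<in> adjacent src tgt (T - {k})"
      using ends[of i] Suc.prems m unfolding adjacent_def by (auto simp: doubleton_eq_iff)
    then show ?case using Suc unfolding joined_def by (simp add: rtrancl_into_rtrancl)
  qed
  from this[of m] have "joined (T - {k}) (vs ! 0) (vs ! m)" by simp
  moreover have "{src k, tgt k} = {vs ! m, vs ! 0}"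
    using ends[of m] m by (simp add: k_def)
  ultimately have "joined (T - {k}) (src k) (tgt k)"
    unfolding joined_iff_component_eq doubleton_eq_iff by auto
  moreover have "k \<in> T" using c(4) m by (auto simp: k_def)
  ultimately show ?thesis by blast
qed

text \<open>
  This form, a connected set of edges all of which are bridges, replaces the search for cycles by
  statements about \<open>joined\<close> alone.
\<close>

lemma spanning_tree_iff:
  "spanning_tree src tgt T \<longleftrightarrow>
    (\<forall>i j. joined T i j) \<and> (\<forall>k\<in>T. \<not> joined (T - {k}) (src k) (tgt k))"
proof -
  have "has_cycle src tgt T \<longleftrightarrow> (\<exists>k\<in>T. joined (T - {k}) (src k) (tgt k))"
    using cycle_if_bypassed_edge bypassed_edge_if_cycle by metis
  then show ?thesis
    unfolding spanning_tree_def joined_def[symmetric] by simp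
qed

text \<open>
  Deleting a bypassed edge keeps a set of edges connected, so a connected set of least cardinality
  is a tree.
\<close>

lemma spanning_tree_exists:
  assumes conn: "\<And>i j. joined UNIV i j"
  shows "\<exists>T. spanning_tree src tgt T"
proof -
  let ?C = "\<lambda>T. \<forall>i j. joined T i j"
  obtain T where T: "?C T" and least: "\<And>T'. ?C T' \<Longrightarrow> card T \<le> card T'"
    using ex_has_least_nat[of ?C UNIV card] conn by blast
  have "\<not> joined (T - {k}) (src k) (tgt k)" if k: "k \<in> T" for k
  proof
    assume j: "joined (T - {k}) (src k) (tgt k)"
    have "joined (T - {k}) a b" for a b
    proof -
      have "joined (insert k (T - {k})) a b"
        using T k by (simp add: insert_absorb)
      then show ?thesis
        using joined_insert[of k "T - {k}" a b] j
        unfolding joined_iff_component_eq by auto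
    qed
    then have "card T \<le> card (T - {k})" by (intro least) auto
    then show False using k by (metis card_Diff1_less finite linorder_not_less)
  qed
  then have "spanning_tree src tgt T"
    unfolding spanning_tree_iff using T by simp
  then show ?thesis ..
qed

lemma spanning_treeD:
  assumes "spanning_tree src tgt T"
  shows "joined T i j" and "k \<in> T \<Longrightarrow> \<not> joined (T - {k}) (src k) (tgt k)"
  using assms unfolding spanning_tree_iff by simp_all

text \<open>
  A tree without its edge \<open>k\<close> has exactly the two components of the ends of \<open>k\<close>.
\<close>

lemma tree_component_iff:
  assumes T: "spanning_tree src tgt T" and k: "k \<in> T"
  shows "i \<in> tree_component src tgt T k \<longleftrightarrow> joined (T - {k}) (src k) i"
    and "i \<notin> tree_component src tgt T k \<longleftrightarrow> joined (T - {k}) (tgt k) i"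
proof -
  show "i \<in> tree_component src tgt T k \<longleftrightarrow> joined (T - {k}) (src k) i"
    by (simp add: tree_component_def joined_def)
  have "joined (insert k (T - {k})) (src k) i"
    using spanning_treeD(1)[OF T] k by (simp add: insert_absorb)
  moreover have "\<not> joined (T - {k}) (src k) (tgt k)"
    using spanning_treeD(2)[OF T k] .
  ultimately show "i \<notin> tree_component src tgt T k \<longleftrightarrow> joined (T - {k}) (tgt k) i"
    using joined_insert[of k "T - {k}" "src k" i]
    unfolding tree_component_def joined_def[symmetric] joined_iff_component_eq by auto
qed

text \<open>
  The \<open>(k, l)\<close> entry of the fundamental cut matrix of the tree \<open>T\<close>: it is nonzero iff \<open>l\<close> joins the two
  components of \<open>T - {k}\<close>, and its sign tells whether \<open>l\<close> crosses in the same direction as \<open>k\<close>.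
\<close>

definition cut_sign :: "'m set \<Rightarrow> 'm \<Rightarrow> 'm \<Rightarrow> real" where
  "cut_sign T k l = of_bool (src l \<in> tree_component src tgt T k)
     - of_bool (tgt l \<in> tree_component src tgt T k)"

text \<open>
  Trading \<open>k\<close> for an edge \<open>l\<close> of its fundamental cut gives another tree \<open>F\<close>, with \<open>F - {l} = T - {k}\<close>;
  so \<open>k\<close> and \<open>l\<close> play symmetric roles, the exchange is undone by the opposite one, and the two signs
  agree.
\<close>

lemma tree_exchange:
  assumes T: "spanning_tree src tgt T" and k: "k \<in> T" and l: "cut_sign T k l \<noteq> 0"
  defines "F \<equiv> insert l (T - {k})"
  shows "spanning_tree src tgt F" "l \<in> F" "T = insert k (F - {l})" "l \<notin> T - {k}" "F - {l} = T - {k}"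
    "cut_sign F l k = cut_sign T k l"
proof -
  let ?A = "T - {k}"
  note comp = tree_component_iff[OF T k]
  have crossing: "joined ?A (src k) (src l) \<and> joined ?A (tgt k) (tgt l) \<or>
      joined ?A (src k) (tgt l) \<and> joined ?A (tgt k) (src l)"
    using l comp(2)[of "src l"] comp(2)[of "tgt l"] comp(1)[of "src l"] comp(1)[of "tgt l"]
    unfolding cut_sign_def by (smt (verit) of_bool_eq)
  have sep: "\<not> joined ?A (src k) (tgt k)"
    using spanning_treeD(2)[OF T k] .
  have sep_l: "\<not> joined ?A (src l) (tgt l)"
    using crossing sep unfolding joined_iff_component_eq by auto
  show lA: "l \<notin> ?A" using sep_l joined_edge[of l ?A] by metis
  show Fl: "F - {l} = ?A" using lA unfolding F_def by blast
  show "l \<in> F" by (simp add: F_def)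
  show "T = insert k (F - {l})" unfolding Fl using k by blast
  have "joined F a b" for a b
  proof -
    have mono: "joined F i j" if "joined ?A i j" for i j
      using that by (rule joined_mono) (simp add: F_def subset_insertI)
    have "joined F (src l) (tgt l)" by (rule joined_edge) (simp add: F_def)
    with crossing mono have kF: "joined F (src k) (tgt k)"
      unfolding joined_iff_component_eq by metis
    have "joined (insert k ?A) a b"
      using spanning_treeD(1)[OF T] k by (simp add: insert_absorb)
    then show ?thesis
      using joined_insert[of k ?A a b] kF mono
      unfolding joined_iff_component_eq by metis
  qed
  moreover have "\<not> joined (F - {e}) (src e) (tgt e)" if e: "e \<in> F" for e
  proof (cases "e = l")
    case True
    then show ?thesis using sep_l Fl by simp
  next
    case False
    then have eA: "e \<in> ?A" using e by (simp add: F_def)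
    have "F - {e} = insert l (?A - {e})" using False by (auto simp: F_def)
    have mono: "joined ?A i j" if "joined (?A - {e}) i j" for i j
      using that by (rule joined_mono) simp
    have "joined ?A (src e) (tgt e)" using eA by (rule joined_edge)
    show ?thesis
    proof
      assume "joined (F - {e}) (src e) (tgt e)"
      then consider "joined (?A - {e}) (src e) (tgt e)"
        | "joined (?A - {e}) (src e) (src l)" "joined (?A - {e}) (tgt l) (tgt e)"
        | "joined (?A - {e}) (src e) (tgt l)" "joined (?A - {e}) (src l) (tgt e)"
        unfolding \<open>F - {e} = insert l (?A - {e})\<close>
        using joined_insert[of l "?A - {e}" "src e" "tgt e"] by metis
      then show False
      proof cases
        case 1
        then have "joined (T - {e}) (src e) (tgt e)" by (rule joined_mono) auto
        then show False using spanning_treeD(2)[OF T, of e] eA by simp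
      next
        case 2
        then show False
          using sep_l mono \<open>joined ?A (src e) (tgt e)\<close>
          unfolding joined_iff_component_eq by metis
      next
        case 3
        then show False
          using sep_l mono \<open>joined ?A (src e) (tgt e)\<close>
          unfolding joined_iff_component_eq by metis
      qed
    qed
  qed
  ultimately show F: "spanning_tree src tgt F"
    unfolding spanning_tree_iff by metis
  have compF: "i \<in> tree_component src tgt F l \<longleftrightarrow> joined ?A (src l) i" for i
    by (simp add: tree_component_def Fl joined_def)
  show "cut_sign F l k = cut_sign T k l"
    unfolding cut_sign_def compF comp(1)
    using crossing sep sep_l unfolding joined_iff_component_eq by auto
qed

text \<open>
  Kirchhoff's voltage law along the path of the tree between the ends of \<open>k\<close>: the edges \<open>l\<close> with
  nonzero sign are those of this path.  The path itself is avoided: the sum is the difference of a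
  potential \<open>\<phi>\<close> over \<open>k\<close>, and \<open>\<phi>\<close> differs from \<open>v\<close> by a constant, since the two have the same differences
  over every edge of the connected set \<open>F\<close>.
\<close>

lemma tree_path_sum:
  assumes F: "spanning_tree src tgt F"
  shows "(\<Sum>l\<in>F. cut_sign F l k * (v (src l) - v (tgt l))) = v (src k) - v (tgt k)"
proof -
  define \<phi> where "\<phi> i = (\<Sum>l\<in>F. of_bool (i \<in> tree_component src tgt F l) * (v (src l) - v (tgt l)))"
    for i
  have diff: "\<phi> (src e) - \<phi> (tgt e) = (\<Sum>l\<in>F. cut_sign F l e * (v (src l) - v (tgt l)))" for e
    unfolding \<phi>_def cut_sign_def by (simp only: left_diff_distrib sum_subtractf)
  have unit: "cut_sign F l e = of_bool (l = e)" if "l \<in> F" "e \<in> F" for l e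
  proof (cases "l = e")
    case True
    then show ?thesis
      using spanning_treeD(2)[OF F] that unfolding cut_sign_def tree_component_def joined_def[symmetric] by auto
  next
    case False
    then have "joined (F - {l}) (src e) (tgt e)" using that by (intro joined_edge) auto
    then show ?thesis
      using False unfolding cut_sign_def tree_component_def joined_def[symmetric] joined_iff_component_eq by simp
  qed
  have "\<phi> (src e) - \<phi> (tgt e) = v (src e) - v (tgt e)" if "e \<in> F" for e
  proof -
    have "\<phi> (src e) - \<phi> (tgt e) = (\<Sum>l\<in>F. if l = e then v (src l) - v (tgt l) else 0)"
      unfolding diff using unit that by (intro sum.cong) auto
    then show ?thesis using that by simp
  qed
  then have "\<phi> (src e) - v (src e) = \<phi> (tgt e) - v (tgt e)" if "e \<in> F" for e
    using that by (simp add: algebra_simps)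
  then have "\<phi> (src k) - v (src k) = \<phi> (tgt k) - v (tgt k)"
    by (rule joined_imp_eq[OF spanning_treeD(1)[OF F], of "\<lambda>i. \<phi> i - v i"])
  then show ?thesis using diff[of k] by (simp add: algebra_simps)
qed

end

section \<open>Kirchhoff's laws by averaging over spanning trees\<close>

context network
begin

abbreviation Inc :: "real ^ 'm ^ 'n" where "Inc \<equiv> incidence src tgt"

lemma incidence_transpose_mult: "(transpose Inc *v v) $ e = v $ src e - v $ tgt e"
proof -
  have "(transpose Inc *v v) $ e = (\<Sum>i\<in>UNIV. (if i = src e then v $ i else 0) - (if i = tgt e then v $ i else 0))"
    unfolding matrix_vector_mult_def transpose_def incidence_def vec_lambda_beta
    using no_loops[of e] by (intro sum.cong) auto
  then show ?thesis by (simp add: sum_subtractf)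
qed

lemma incidence_mult_inner: "v \<bullet> (Inc *v c) = (\<Sum>e\<in>UNIV. (v $ src e - v $ tgt e) * c $ e)"
proof -
  have "v \<bullet> (Inc *v c) = (transpose Inc *v v) \<bullet> c"
    by (simp add: dot_lmul_matrix transpose_matrix_vector)
  also have "\<dots> = (\<Sum>e\<in>UNIV. (v $ src e - v $ tgt e) * c $ e)"
    by (simp add: inner_vec_def incidence_transpose_mult)
  finally show ?thesis .
qed

text \<open>
  Column \<open>i\<close> minus column \<open>j\<close> is the mean, over the random spanning tree with probabilities
  proportional to \<open>tree_weight H\<close>, of the unit flow from \<open>i\<close> to \<open>j\<close> along the tree.
\<close>

definition tree_average :: "real ^ 'm ^ 'm \<Rightarrow> real ^ 'n ^ 'm" where
  "tree_average H = (\<chi> k i. 1 / (\<Sum>T | spanning_tree src tgt T. tree_weight H T) *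
     (\<Sum>T | spanning_tree src tgt T \<and> k \<in> T \<and> i \<in> tree_component src tgt T k. tree_weight H T))"

lemma X_matrix_eq: "X_matrix src tgt cap cost \<zeta> = tree_average (H_matrix src tgt cap cost \<zeta>)"
  by (simp add: X_matrix_def tree_average_def Let_def)

text \<open>
  The exchange \<open>(T, l) \<mapsto> (T - {k} \<union> {l}, l)\<close> moves the factor \<open>c l\<close> into the tree weight and takes \<open>c k\<close>
  out of it.  Afterwards the inner sums are voltage drops along tree paths and no longer depend
  on the tree.
\<close>

lemma tree_exchange_sum:
  fixes c :: "'m \<Rightarrow> real" and v :: "'n \<Rightarrow> real"
  shows "(\<Sum>T | spanning_tree src tgt T \<and> k \<in> T. \<Sum>l\<in>UNIV.
            cut_sign T k l * (\<Prod>e\<in>T. c e) * (c l * (v (src l) - v (tgt l))))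
     = c k * (v (src k) - v (tgt k)) * (\<Sum>T | spanning_tree src tgt T. \<Prod>e\<in>T. c e)"
proof -
  let ?d = "\<lambda>l. v (src l) - v (tgt l)" and ?w = "\<lambda>T. \<Prod>e\<in>T. c e"
  let ?A = "{(T, l). spanning_tree src tgt T \<and> k \<in> T \<and> cut_sign T k l \<noteq> 0}"
  let ?B = "{(F, l). spanning_tree src tgt F \<and> l \<in> F \<and> cut_sign F l k \<noteq> 0}"
  have "(\<Sum>T | spanning_tree src tgt T \<and> k \<in> T. \<Sum>l\<in>UNIV. cut_sign T k l * ?w T * (c l * ?d l))
      = (\<Sum>(T, l)\<in>{T. spanning_tree src tgt T \<and> k \<in> T} \<times> UNIV. cut_sign T k l * ?w T * (c l * ?d l))"
    by (simp add: sum.cartesian_product)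
  also have "\<dots> = (\<Sum>(T, l)\<in>?A. cut_sign T k l * ?w T * (c l * ?d l))"
    by (intro sum.mono_neutral_right) auto
  also have "\<dots> = (\<Sum>(F, l)\<in>?B. cut_sign F l k * ?d l * (c k * ?w F))"
  proof (rule sum.reindex_bij_witness[
      where j = "\<lambda>(T, l). (insert l (T - {k}), l)" and i = "\<lambda>(F, l). (insert k (F - {l}), l)"])
    fix a assume "a \<in> ?A"
    then obtain T l where a: "a = (T, l)" "spanning_tree src tgt T" "k \<in> T" "cut_sign T k l \<noteq> 0"
      by auto
    note ex = tree_exchange[OF a(2-4)]
    show "(\<lambda>(F, l). (insert k (F - {l}), l)) ((\<lambda>(T, l). (insert l (T - {k}), l)) a) = a"
      using ex(3) a(1) by simp
    show "(\<lambda>(T, l). (insert l (T - {k}), l)) a \<in> ?B"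
      using ex a by simp
    have "?w T * c l = c k * ?w (insert l (T - {k}))"
      using a(3) ex(4) by (simp add: prod.remove[OF finite a(3)] algebra_simps)
    then show "(case (\<lambda>(T, l). (insert l (T - {k}), l)) a of (F, l) \<Rightarrow> cut_sign F l k * ?d l * (c k * ?w F))
        = (case a of (T, l) \<Rightarrow> cut_sign T k l * ?w T * (c l * ?d l))"
      using ex(6) a(1) by simp
  next
    fix b assume "b \<in> ?B"
    then obtain F l where b: "b = (F, l)" "spanning_tree src tgt F" "l \<in> F" "cut_sign F l k \<noteq> 0"
      by auto
    note ex = tree_exchange[OF b(2-4)]
    show "(\<lambda>(T, l). (insert l (T - {k}), l)) ((\<lambda>(F, l). (insert k (F - {l}), l)) b) = b"
      using ex(3) b(1) by simp
    show "(\<lambda>(F, l). (insert k (F - {l}), l)) b \<in> ?A"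
      using ex b by simp
  qed
  also have "\<dots> = (\<Sum>(F, l)\<in>Sigma {F. spanning_tree src tgt F} (\<lambda>F. F). cut_sign F l k * ?d l * (c k * ?w F))"
    by (intro sum.mono_neutral_left) auto
  also have "\<dots> = (\<Sum>F | spanning_tree src tgt F. \<Sum>l\<in>F. cut_sign F l k * ?d l * (c k * ?w F))"
    by (simp add: sum.Sigma)
  also have "\<dots> = (\<Sum>F | spanning_tree src tgt F. ?d k * (c k * ?w F))"
    by (intro sum.cong refl) (simp add: tree_path_sum flip: sum_distrib_right)
  also have "\<dots> = c k * ?d k * (\<Sum>F | spanning_tree src tgt F. ?w F)"
    by (simp add: sum_distrib_left mult_ac)
  finally show ?thesis .
qed

text \<open>
  For conductances \<open>H\<close> and a potential \<open>v\<close>, the current \<open>H B\<^sup>T v\<close> is recovered from its net outflow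
  \<open>B H B\<^sup>T v\<close> by routing that outflow along random spanning trees.  This is Kirchhoff's theorem on
  resistor networks; it says that \<open>X\<close> acts on balanced vectors as \<open>H B\<^sup>T (B H B\<^sup>T)\<^sup>+\<close>.
\<close>

lemma tree_average_reproduces_currents:
  fixes H :: "real ^ 'm ^ 'm"
  assumes conn: "\<And>i j. joined UNIV i j"
    and diag: "\<And>e l. e \<noteq> l \<Longrightarrow> H $ e $ l = 0" and pos: "\<And>e. H $ e $ e > 0"
  shows "tree_average H *v (Inc *v (H *v (transpose Inc *v v))) = H *v (transpose Inc *v v)"
proof -
  have H_mult: "(H *v z) $ e = H $ e $ e * z $ e" for z e
  proof -
    have "(H *v z) $ e = (\<Sum>l\<in>UNIV. if l = e then H $ e $ e * z $ e else 0)"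
      unfolding matrix_vector_mult_def vec_lambda_beta using diag by (intro sum.cong) auto
    then show ?thesis by simp
  qed
  let ?w = "tree_weight H" and ?z = "transpose Inc *v v"
  let ?hbar = "\<Sum>T | spanning_tree src tgt T. ?w T"
  have w: "?w T = (\<Prod>e\<in>T. H $ e $ e)" for T by (simp add: tree_weight_def)
  have "?hbar > 0"
    using spanning_tree_exists[OF conn] by (intro sum_pos) (auto simp: w pos prod_pos)
  have entry: "(tree_average H *v (Inc *v c)) $ k = (\<Sum>T | spanning_tree src tgt T \<and> k \<in> T. \<Sum>l\<in>UNIV.
        cut_sign T k l * ?w T * c $ l) / ?hbar" for c k
  proof -
    have row: "tree_average H $ k $ i = (\<Sum>T | spanning_tree src tgt T \<and> k \<in> T.
        of_bool (i \<in> tree_component src tgt T k) * ?w T) / ?hbar" for i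
    proof -
      have "(\<Sum>T | spanning_tree src tgt T \<and> k \<in> T \<and> i \<in> tree_component src tgt T k. ?w T) =
          (\<Sum>T | spanning_tree src tgt T \<and> k \<in> T. of_bool (i \<in> tree_component src tgt T k) * ?w T)"
        by (rule sum.mono_neutral_cong_left) auto
      then show ?thesis by (simp add: tree_average_def)
    qed
    have "(tree_average H *v (Inc *v c)) $ k = tree_average H $ k \<bullet> (Inc *v c)"
      by (simp add: matrix_vector_mul_component)
    also have "\<dots> = (\<Sum>l\<in>UNIV. (\<Sum>T | spanning_tree src tgt T \<and> k \<in> T. cut_sign T k l * ?w T) / ?hbar * c $ l)"
      unfolding incidence_mult_inner row cut_sign_def
      by (simp only: diff_divide_distrib[symmetric] left_diff_distrib sum_subtractf)
    also have "\<dots> = (\<Sum>l\<in>UNIV. \<Sum>T | spanning_tree src tgt T \<and> k \<in> T. cut_sign T k l * ?w T * c $ l) / ?hbar"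
      by (simp add: sum_divide_distrib sum_distrib_right)
    finally show ?thesis by (simp add: sum.swap[of _ UNIV])
  qed
  show ?thesis
  proof (unfold vec_eq_iff, rule allI)
    fix k
    have "(tree_average H *v (Inc *v (H *v ?z))) $ k = H $ k $ k * (v $ src k - v $ tgt k) * ?hbar / ?hbar"
      unfolding entry H_mult incidence_transpose_mult w
      using tree_exchange_sum[of k "\<lambda>e. H $ e $ e" "\<lambda>i. v $ i"] by simp
    also have "\<dots> = (H *v ?z) $ k"
      using \<open>?hbar > 0\<close> by (simp add: H_mult incidence_transpose_mult)
    finally show "(tree_average H *v (Inc *v (H *v ?z))) $ k = (H *v ?z) $ k" .
  qed
qed

end

section \<open>Centering, Laplacian and pseudo-inverse\<close>

lemma inner_matrix_vector: "x \<bullet> (A *v y) = (transpose A *v x) \<bullet> y" for A :: "real ^ 'b ^ 'a"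
  by (simp add: dot_lmul_matrix transpose_matrix_vector)

text \<open>
  Written with differences, a centred vector is visibly controlled by potential differences.
\<close>

lemma centering_mult_nth: "(centering *v v) $ i = (\<Sum>j\<in>UNIV. v $ i - v $ j) / real CARD('n)"
  for v :: "real ^ 'n"
proof -
  have "(((1 / real CARD('n)) *\<^sub>R (\<chi> i j. 1) :: real ^ 'n ^ 'n) *v v) $ i = (\<Sum>j\<in>UNIV. v $ j) / real CARD('n)"
    by (simp add: matrix_vector_mult_def sum_divide_distrib)
  then show ?thesis
    unfolding centering_def matrix_vector_mult_diff_rdistrib
    by (simp add: sum_subtractf diff_divide_distrib)
qed

lemma centering_mult_id: "(\<chi> i. 1) \<bullet> v = 0 \<Longrightarrow> centering *v v = v"
  by (simp add: vec_eq_iff centering_mult_nth sum_subtractf inner_vec_def)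

lemma ones_inner_centering: "(\<chi> i. 1) \<bullet> (centering *v v) = 0" for v :: "real ^ 'n"
proof -
  have "(\<chi> i. 1) \<bullet> (centering *v v) = (\<Sum>i\<in>UNIV. (\<Sum>j\<in>UNIV. v $ i - v $ j)) / real CARD('n)"
    by (simp add: inner_vec_def centering_mult_nth sum_divide_distrib)
  then show ?thesis by (simp add: sum_subtractf flip: sum_distrib_left)
qed

lemma centering_idem: "centering *v (centering *v v) = centering *v v"
  by (rule centering_mult_id[OF ones_inner_centering])

lemma transpose_centering: "transpose centering = centering"
  by (simp add: centering_def transpose_def vec_eq_iff mat_def)

text \<open>
  Penrose's uniqueness argument: two solutions \<open>Y\<close>, \<open>Z\<close> give the same projections \<open>A Y = A Z\<close> and
  \<open>Y A = Z A\<close>, because taking transposes reverses the products.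
\<close>

lemma pseudo_inverse_eqI:
  fixes A :: "real ^ 'b ^ 'a"
  assumes "A ** Y ** A = A" "Y ** A ** Y = Y" "transpose (A ** Y) = A ** Y" "transpose (Y ** A) = Y ** A"
  shows "pseudo_inverse A = Y"
  unfolding pseudo_inverse_def
proof (rule the_equality)
  fix Z
  assume Z: "A ** Z ** A = A \<and> Z ** A ** Z = Z \<and> transpose (A ** Z) = A ** Z \<and> transpose (Z ** A) = Z ** A"
  have "A ** Y = transpose (A ** Y)" using assms(3) by simp
  also have "\<dots> = transpose (A ** Z ** (A ** Y))" using Z by (simp add: matrix_mul_assoc)
  also have "\<dots> = A ** Y ** (A ** Z)" using Z assms(3) by (simp add: matrix_transpose_mul)
  also have "\<dots> = A ** Z" using assms(1) by (simp add: matrix_mul_assoc)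
  finally have AY: "A ** Y = A ** Z" .
  have "Y ** A = transpose (Y ** A)" using assms(4) by simp
  also have "\<dots> = transpose (Y ** A ** (Z ** A))" using Z by (simp flip: matrix_mul_assoc)
  also have "\<dots> = Z ** A ** (Y ** A)" using Z assms(4) by (simp add: matrix_transpose_mul)
  also have "\<dots> = Z ** A" using assms(1) by (simp flip: matrix_mul_assoc)
  finally have YA: "Y ** A = Z ** A" .
  have "Z = Z ** A ** Z" using Z by simp
  also have "\<dots> = Y ** A ** Z" by (simp add: YA)
  also have "\<dots> = Y ** A ** Y" by (metis AY matrix_mul_assoc)
  finally show "Z = Y" using assms(2) by simp
qed (use assms in simp)

lemma matrix_inv_right:
  assumes "invertible A" shows "A ** matrix_inv A = mat 1"
proof -
  have "A ** matrix_inv A = mat 1 \<and> matrix_inv A ** A = mat 1"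
    using assms unfolding invertible_def matrix_inv_def by (rule someI_ex)
  then show ?thesis by simp
qed

context network
begin

text \<open>
  If \<open>j\<close> were not reached from \<open>i\<close>, the set of nodes reached from \<open>i\<close> would be cut by no edge of \<open>T\<close>.
\<close>

lemma joined_if_cuts_meet:
  assumes "\<And>S. S \<noteq> {} \<Longrightarrow> S \<subset> UNIV \<Longrightarrow> \<exists>e\<in>T. e \<in> cut src tgt S"
  shows "joined T i j"
proof (rule ccontr)
  assume "\<not> joined T i j"
  then have "{l. joined T i l} \<noteq> {}" "{l. joined T i l} \<subset> UNIV"
    using joined_refl[of T i] by blast+
  from assms[OF this] obtain e where "e \<in> T" "joined T i (src e) \<noteq> joined T i (tgt e)"
    by (auto simp: cut_def)
  then show False
    using joined_edge[of e T] unfolding joined_iff_component_eq by simp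
qed

text \<open>
  The constant \<open>p\<close> is the length of a walk from \<open>i\<close> to \<open>j\<close>; what matters is that it serves all
  potentials \<open>v\<close> at once.
\<close>

lemma potential_difference_bound:
  assumes "joined T i j"
  shows "\<exists>p\<ge>0. \<forall>v :: real ^ 'n. \<forall>M. (\<forall>e\<in>T. \<bar>v $ src e - v $ tgt e\<bar> \<le> M) \<longrightarrow> 0 \<le> M \<longrightarrow>
    \<bar>v $ i - v $ j\<bar> \<le> p * M"
  using assms
proof (induction rule: joined_induct)
  case base
  show ?case by (intro exI[of _ 0]) auto
next
  case (step b c)
  from step.IH obtain p where p: "p \<ge> 0"
    "\<And>v :: real ^ 'n. \<And>M. \<forall>e\<in>T. \<bar>v $ src e - v $ tgt e\<bar> \<le> M \<Longrightarrow> 0 \<le> M \<Longrightarrow> \<bar>v $ i - v $ b\<bar> \<le> p * M"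
    by blast
  have "\<bar>v $ i - v $ c\<bar> \<le> (p + 1) * M" if M: "\<forall>e\<in>T. \<bar>v $ src e - v $ tgt e\<bar> \<le> M" "0 \<le> M" for v :: "real ^ 'n" and M
  proof -
    have "\<bar>v $ b - v $ c\<bar> \<le> M"
      using M(1) step.hyps(2) by (auto simp: adjacent_def abs_minus_commute)
    then show ?thesis using p(2)[OF M] by (simp add: distrib_right)
  qed
  then show ?case using p(1) by (intro exI[of _ "p + 1"]) auto
qed

text \<open>
  Used twice: with all edges for the Poincare inequality behind the exponential decay, and with the
  uncapacitated edges to bound the controller state.
\<close>

lemma centering_bound:
  assumes "\<And>i j. joined T i j"
  shows "\<exists>K>0. \<forall>v :: real ^ 'n. \<forall>M. (\<forall>e\<in>T. \<bar>v $ src e - v $ tgt e\<bar> \<le> M) \<longrightarrow> 0 \<le> M \<longrightarrow>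
    norm (centering *v v) \<le> K * M"
proof -
  obtain p where p: "\<And>i j. p i j \<ge> 0"
    "\<And>i j. \<And>v :: real ^ 'n. \<And>M. \<forall>e\<in>T. \<bar>v $ src e - v $ tgt e\<bar> \<le> M \<Longrightarrow> 0 \<le> M \<Longrightarrow> \<bar>v $ i - v $ j\<bar> \<le> p i j * M"
    using potential_difference_bound[OF assms] by metis
  define K where "K = 1 + (\<Sum>i\<in>UNIV. \<Sum>j\<in>UNIV. p i j)"
  have "norm (centering *v v) \<le> K * M"
    if M: "\<forall>e\<in>T. \<bar>v $ src e - v $ tgt e\<bar> \<le> M" "0 \<le> M" for v :: "real ^ 'n" and M
  proof -
    have "\<bar>(centering *v v) $ i\<bar> \<le> (\<Sum>j\<in>UNIV. p i j * M)" for i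
    proof -
      have "\<bar>(centering *v v) $ i\<bar> = \<bar>\<Sum>j\<in>UNIV. v $ i - v $ j\<bar> / real CARD('n)"
        by (simp add: centering_mult_nth)
      also have "\<dots> \<le> \<bar>\<Sum>j\<in>UNIV. v $ i - v $ j\<bar> / 1"
        by (intro divide_left_mono) (simp_all add: Suc_leI)
      also have "\<dots> \<le> (\<Sum>j\<in>UNIV. \<bar>v $ i - v $ j\<bar>)" by simp
      also have "\<dots> \<le> (\<Sum>j\<in>UNIV. p i j * M)" by (intro sum_mono p(2)[OF M])
      finally show ?thesis .
    qed
    then have "norm (centering *v v) \<le> (\<Sum>i\<in>UNIV. \<Sum>j\<in>UNIV. p i j * M)"
      by (intro order_trans[OF norm_le_l1_cart] sum_mono)
    also have "\<dots> = (\<Sum>i\<in>UNIV. \<Sum>j\<in>UNIV. p i j) * M" by (simp add: sum_distrib_right)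
    also have "\<dots> \<le> K * M" unfolding K_def using M(2) by (intro mult_right_mono) auto
    finally show ?thesis .
  qed
  moreover have "K > 0" unfolding K_def by (simp add: add_pos_nonneg p(1) sum_nonneg)
  ultimately show ?thesis by blast
qed

lemma poincare_inequality:
  assumes "\<And>i j. joined UNIV i j"
  shows "\<exists>K>0. \<forall>v. norm (centering *v v) \<le> K * norm (transpose Inc *v v)"
proof -
  obtain K where "K > 0" and K: "\<And>v :: real ^ 'n. \<And>M. \<forall>e\<in>UNIV. \<bar>v $ src e - v $ tgt e\<bar> \<le> M \<Longrightarrow>
      0 \<le> M \<Longrightarrow> norm (centering *v v) \<le> K * M"
    using centering_bound[OF assms] by metis
  moreover have "\<bar>v $ src e - v $ tgt e\<bar> \<le> norm (transpose Inc *v v)" for v e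
    using component_le_norm_cart[of "transpose Inc *v v" e] by (simp add: incidence_transpose_mult)
  ultimately show ?thesis by (metis norm_ge_zero)
qed

lemma transpose_incidence_centering: "transpose Inc *v (centering *v v) = transpose Inc *v v"
  unfolding vec_eq_iff incidence_transpose_mult centering_mult_nth
  by (simp add: sum_subtractf diff_divide_distrib)

lemma ones_inner_incidence: "(\<chi> i. 1) \<bullet> (Inc *v c) = 0"
  by (simp add: incidence_mult_inner)

text \<open>
  The kernel of \<open>L\<close> is spanned by the all-ones vector, onto which \<open>mat 1 - centering\<close> projects.  Hence
  \<open>A = L + (mat 1 - centering)\<close> is invertible, it agrees with \<open>L\<close> on centred vectors, and
  \<open>centering ** A'\<close> with the inverse \<open>A'\<close> of \<open>A\<close> satisfies the Penrose equations.
\<close>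

lemma laplacian_pseudo_inverse:
  assumes conn: "\<And>i j. joined UNIV i j"
  defines "L \<equiv> Inc ** transpose Inc"
  shows "L ** pseudo_inverse L = centering"
proof -
  let ?C = "centering :: real ^ 'n ^ 'n"
  define A where "A = L + (mat 1 - ?C)"
  have A: "A *v v = L *v v + (v - ?C *v v)" for v
    by (simp add: A_def matrix_vector_mult_add_rdistrib matrix_vector_mult_diff_rdistrib)
  have L: "L *v v = Inc *v (transpose Inc *v v)" for v
    by (simp add: L_def matrix_vector_mul_assoc)
  have CC: "?C ** ?C = ?C"
    unfolding matrix_eq by (simp add: centering_idem flip: matrix_vector_mul_assoc)
  have CL: "?C *v (L *v v) = L *v v" for v
    unfolding L by (intro centering_mult_id ones_inner_incidence)
  have AC: "A ** ?C = L" and CA: "?C ** A = L"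
    unfolding matrix_eq matrix_vector_mul_assoc[symmetric] A matrix_vector_right_distrib
      matrix_vector_mult_diff_distrib centering_idem CL
    by (simp_all add: L transpose_incidence_centering)
  have "v = 0" if "A *v v = 0" for v
  proof -
    have "(A *v v) \<bullet> v = (norm (transpose Inc *v v))\<^sup>2 + (norm (v - ?C *v v))\<^sup>2"
    proof -
      have "(L *v v) \<bullet> v = (norm (transpose Inc *v v))\<^sup>2"
        unfolding L power2_norm_eq_inner by (subst inner_commute) (rule inner_matrix_vector)
      moreover have "(v - ?C *v v) \<bullet> (?C *v v) = 0"
        by (subst inner_matrix_vector)
          (simp add: transpose_centering matrix_vector_mult_diff_distrib centering_idem)
      then have "(v - ?C *v v) \<bullet> v = (norm (v - ?C *v v))\<^sup>2"
        by (simp add: power2_norm_eq_inner inner_diff_right)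
      ultimately show ?thesis unfolding A by (simp add: inner_add_left)
    qed
    with that have eqs: "transpose Inc *v v = 0" "v = ?C *v v"
      by (simp_all add: add_nonneg_eq_0_iff)
    with poincare_inequality[OF conn] show "v = 0"
      by (metis mult_zero_right norm_le_zero_iff norm_zero)
  qed
  then obtain A' where A'A: "A' ** A = mat 1"
    using matrix_left_invertible_ker by blast
  then have AA': "A ** A' = mat 1"
    using matrix_left_right_inverse by blast
  define Y where "Y = ?C ** A'"
  have LY: "L ** Y = ?C"
    unfolding Y_def by (metis AC AA' CA CC matrix_mul_assoc matrix_mul_rid)
  have YL: "Y ** L = ?C"
    unfolding Y_def by (metis AC A'A CC matrix_mul_assoc matrix_mul_lid)
  have "pseudo_inverse L = Y"
  proof (rule pseudo_inverse_eqI)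
    show "L ** Y ** L = L" unfolding LY matrix_eq by (simp add: CL flip: matrix_vector_mul_assoc)
    show "Y ** L ** Y = Y" unfolding YL by (simp only: Y_def matrix_mul_assoc CC)
  qed (simp_all add: LY YL transpose_centering)
  with LY show ?thesis by simp
qed

text \<open>
  On balanced vectors \<open>\<Xi>\<close> inverts the weighted Laplacian \<open>B H B\<^sup>T\<close> from the right.  Tested against a
  vector \<open>v\<close>, the claim moves all factors to the left argument, where \<open>X B H B\<^sup>T v\<close> collapses to the
  current \<open>H B\<^sup>T v\<close>; then \<open>H\<close> cancels and \<open>B B\<^sup>T\<close> meets its pseudo-inverse.
\<close>

lemma Xi_matrix_inverts:
  fixes \<zeta> u :: "real ^ 'n" and cap :: "'m \<Rightarrow> ereal" and cost :: "'m \<Rightarrow> real \<Rightarrow> ereal"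
  assumes conn: "\<And>i j. joined UNIV i j"
    and pos: "\<And>e z. deriv (marginal_cost_inv (cap e) (cost e)) z > 0"
  defines "H \<equiv> H_matrix src tgt cap cost \<zeta>"
  shows "Inc *v (H *v (transpose Inc *v (Xi_matrix src tgt cap cost \<zeta> *v u))) = centering *v u"
proof -
  have diag: "H $ e $ l = 0" if "e \<noteq> l" for e l
    using that by (simp add: H_def H_matrix_def D_grad_cost_inv_def)
  have Hpos: "H $ e $ e > 0" for e
    using pos by (simp add: H_def H_matrix_def D_grad_cost_inv_def)
  have H_sym: "transpose H = H"
    using diag by (auto simp: transpose_def vec_eq_iff) metis
  have "H ** (\<chi> e l. if e = l then 1 / H $ e $ e else 0) = mat 1"
  proof -
    have "(\<Sum>j\<in>UNIV. H $ e $ j * (if j = l then 1 / H $ j $ j else 0)) = (if e = l then 1 else 0)" for e l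
    proof -
      have "(\<Sum>j\<in>UNIV. H $ e $ j * (if j = l then 1 / H $ j $ j else 0)) = H $ e $ l / H $ l $ l"
        by (simp add: if_distrib[of "\<lambda>x. _ * x"] cong: if_cong)
      then show ?thesis using diag[of e l] Hpos[of l] by auto
    qed
    then show ?thesis by (simp add: matrix_matrix_mult_def mat_def vec_eq_iff)
  qed
  then have "invertible H" using invertible_right_inverse by blast
  note H_inv = matrix_inv_right[OF this]
  let ?X = "tree_average H" and ?L = "Inc ** transpose Inc"
  define q where "q = pseudo_inverse ?L *v u"
  have Xi: "Xi_matrix src tgt cap cost \<zeta> *v u = transpose ?X *v (matrix_inv H *v (transpose Inc *v q))"
    unfolding Xi_matrix_def X_matrix_eq Let_def H_def q_def by (simp add: matrix_vector_mul_assoc matrix_mul_assoc)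
  have "v \<bullet> (Inc *v (H *v (transpose Inc *v (Xi_matrix src tgt cap cost \<zeta> *v u)))) = v \<bullet> (centering *v u)" for v
  proof -
    have "v \<bullet> (Inc *v (H *v (transpose Inc *v (Xi_matrix src tgt cap cost \<zeta> *v u))))
        = (?X *v (Inc *v (H *v (transpose Inc *v v)))) \<bullet> (matrix_inv H *v (transpose Inc *v q))"
      unfolding Xi by (simp only: inner_matrix_vector H_sym transpose_transpose)
    also have "\<dots> = (H *v (transpose Inc *v v)) \<bullet> (matrix_inv H *v (transpose Inc *v q))"
      by (simp add: tree_average_reproduces_currents[OF conn diag Hpos])
    also have "\<dots> = (transpose Inc *v v) \<bullet> (H *v (matrix_inv H *v (transpose Inc *v q)))"
      by (simp only: inner_matrix_vector[of _ H] H_sym)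
    also have "\<dots> = (transpose Inc *v v) \<bullet> (transpose Inc *v q)"
      by (simp add: matrix_vector_mul_assoc[of H] H_inv)
    also have "\<dots> = v \<bullet> ((?L ** pseudo_inverse ?L) *v u)"
      by (simp only: q_def inner_matrix_vector[of v Inc] flip: matrix_vector_mul_assoc)
    finally show ?thesis by (simp add: laplacian_pseudo_inverse[OF conn])
  qed
  then show ?thesis by (metis vector_eq_ldot)
qed

end

section \<open>Inverse marginal costs\<close>

locale legendre_cost =
  fixes c :: ereal and f :: "real \<Rightarrow> ereal"
  assumes legendre: "legendre_type c f" and c_pos: "0 < c"
begin

abbreviation I :: "real set" where "I \<equiv> capacity_interval c"
abbreviation mc :: "real \<Rightarrow> real" where "mc \<equiv> marginal_cost f"
abbreviation g :: "real \<Rightarrow> real" where "g \<equiv> marginal_cost_inv c f"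

lemma open_interval: "open I" "connected I" "0 \<in> I"
proof -
  show "open I"
  proof (cases c)
    case (real r)
    then have "I = {- r <..< r}" by (auto simp: capacity_interval_def)
    then show ?thesis by simp
  next
    case PInf
    then have "I = UNIV" by (auto simp: capacity_interval_def)
    then show ?thesis by simp
  next
    case MInf
    then have "I = {}" by (auto simp: capacity_interval_def)
    then show ?thesis by simp
  qed
  show "connected I"
    using legendre by (auto simp: legendre_type_def strictly_convex_on_def intro: convex_connected)
  show "0 \<in> I" using c_pos by (simp add: capacity_interval_def zero_ereal_def)
qed

lemma cost_deriv:
  assumes "l \<in> I"
  shows "((\<lambda>l. real_of_ereal (f l)) has_real_derivative mc l) (at l)"
proof -
  have "(deriv ^^ 0) (\<lambda>l. real_of_ereal (f l)) field_differentiable (at l)"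
    using legendre assms unfolding legendre_type_def smooth_on_open_def by blast
  then show ?thesis
    by (simp add: marginal_cost_def DERIV_deriv_iff_field_differentiable)
qed

lemma marginal_cost_continuous: "continuous_on I mc"
proof (rule continuous_at_imp_continuous_on, rule ballI)
  fix l assume "l \<in> I"
  then have "(deriv ^^ 1) (\<lambda>l. real_of_ereal (f l)) field_differentiable (at l)"
    using legendre unfolding legendre_type_def smooth_on_open_def by blast
  then show "isCont mc l"
    by (simp add: marginal_cost_def field_differentiable_imp_continuous_at)
qed

text \<open>
  With equal slopes at \<open>x\<close> and \<open>y\<close> the two tangent inequalities leave only the affine function between
  them, against strict convexity at the midpoint.
\<close>

lemma marginal_cost_neq:
  assumes x: "x \<in> I" and y: "y \<in> I" and "x < y"
  shows "mc x \<noteq> mc y"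
proof
  assume eq: "mc x = mc y"
  let ?F = "\<lambda>l. real_of_ereal (f l)" and ?m = "(x + y) / 2"
  have I_convex: "convex I" and strict: "\<And>x y u. x \<in> I \<Longrightarrow> y \<in> I \<Longrightarrow> x \<noteq> y \<Longrightarrow> 0 < u \<Longrightarrow> u < 1 \<Longrightarrow>
      ?F ((1 - u) * x + u * y) < (1 - u) * ?F x + u * ?F y"
    using legendre unfolding legendre_type_def strictly_convex_on_def by auto
  have "convex_on I ?F"
  proof (rule convex_onI[OF _ I_convex])
    fix t x y :: real
    assume "0 < t" "t < 1" "x \<in> I" "y \<in> I"
    then show "?F ((1 - t) *\<^sub>R x + t *\<^sub>R y) \<le> (1 - t) * ?F x + t * ?F y"
      using strict[of x y t] by (cases "x = y") (auto simp: algebra_simps)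
  qed
  then have tangent: "?F b - ?F a \<ge> mc a * (b - a)" if "a \<in> I" "b \<in> I" for a b
    using that open_interval cost_deriv[OF that(1)]
    by (intro convex_on_imp_above_tangent[where A = I]) (auto simp: interior_open intro: has_field_derivative_at_within)
  have m: "?m \<in> I"
    using convexD[OF I_convex x y, of "1/2" "1/2"] by (simp add: field_simps)
  have "?F ?m < (?F x + ?F y) / 2"
    using strict[of x y "1/2"] x y \<open>x < y\<close> by (simp add: field_simps)
  moreover have "?F y - ?F x = mc x * (y - x)"
    using tangent[OF x y] tangent[OF y x] eq by (simp add: algebra_simps)
  moreover have "?F ?m - ?F x \<ge> mc x * (?m - x)"
    by (rule tangent[OF x m])
  moreover have "mc x * (?m - x) = mc x * (y - x) / 2"
    by (simp add: field_simps)
  ultimately show False by argo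
qed

lemma marginal_cost_inj: "inj_on mc I"
  by (rule linorder_inj_onI) (use marginal_cost_neq in \<open>auto\<close>)

lemma inverse_deriv: "(g has_real_derivative deriv g z) (at z)"
  using legendre unfolding legendre_type_def DERIV_deriv_iff_field_differentiable by blast

lemma inverse_deriv_pos: "deriv g z > 0"
  using legendre unfolding legendre_type_def by blast

lemma inverse_strict_mono: "strict_mono g"
  by (rule strict_monoI, rule DERIV_pos_imp_increasing)
    (use inverse_deriv inverse_deriv_pos in blast)+

text \<open>
  Outside the range of \<open>mc\<close>, \<open>inv_into\<close> has one fixed default value.  As \<open>g\<close> is injective, the range omits
  at most one number; as the range is an interval, it omits none.
\<close>

lemma marginal_cost_surj: "mc ` I = UNIV"
proof (rule equalityI[OF subset_UNIV], rule subsetI)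
  fix z
  have outside: "a = b" if "a \<notin> mc ` I" "b \<notin> mc ` I" for a b
  proof -
    have "g a = g b"
      using that unfolding marginal_cost_inv_def inv_into_def by (metis imageI)
    then show ?thesis using inverse_strict_mono by (simp add: strict_mono_eq)
  qed
  show "z \<in> mc ` I"
  proof (rule ccontr)
    assume z: "z \<notin> mc ` I"
    then have "z - 1 \<in> mc ` I" "z + 1 \<in> mc ` I"
      using outside[of z "z - 1"] outside[of z "z + 1"] by auto
    moreover have "connected (mc ` I)"
      by (rule connected_continuous_image[OF marginal_cost_continuous open_interval(2)])
    ultimately have "z \<in> mc ` I"
      by (auto intro: connectedD_interval[of "mc ` I" "z - 1" "z + 1"])
    with z show False ..
  qed
qed

lemma inverse_in_interval: "g z \<in> I"
  unfolding marginal_cost_inv_def using marginal_cost_surj by (intro inv_into_into) simp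

lemma marginal_cost_inverse: "mc (g z) = z"
  unfolding marginal_cost_inv_def using marginal_cost_surj by (intro f_inv_into_f) simp

lemma inverse_marginal_cost: "l \<in> I \<Longrightarrow> g (mc l) = l"
  unfolding marginal_cost_inv_def by (intro inv_into_f_f marginal_cost_inj)

text \<open>
  Without a capacity, \<open>g\<close> takes the values \<open>g 0 + R\<close> and \<open>g 0 - R\<close>, and their preimages enclose \<open>z\<close>.
\<close>

lemma inverse_coercive:
  assumes "c = \<infinity>"
  shows "\<exists>M\<ge>0. \<forall>z. \<bar>g z - g 0\<bar> \<le> R \<longrightarrow> \<bar>z\<bar> \<le> M"
proof (intro exI conjI allI impI)
  let ?M = "\<bar>mc (g 0 + R)\<bar> + \<bar>mc (g 0 - R)\<bar>"
  show "0 \<le> ?M" by simp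
  fix z assume "\<bar>g z - g 0\<bar> \<le> R"
  moreover have "g (mc l) = l" for l
    using assms by (intro inverse_marginal_cost) (simp add: capacity_interval_def)
  ultimately have "g z \<le> g (mc (g 0 + R))" "g (mc (g 0 - R)) \<le> g z"
    by simp_all
  then have "z \<le> mc (g 0 + R)" "mc (g 0 - R) \<le> z"
    using inverse_strict_mono by (simp_all add: strict_mono_less_eq)
  then show "\<bar>z\<bar> \<le> ?M" by linarith
qed

end

section \<open>Bounded imbalance forces bounded potential differences\<close>

context network
begin

text \<open>
  Pairing the imbalance caused by \<open>\<zeta>\<close>, relative to zero potential differences, with \<open>\<zeta>\<close> itself gives
  the sum over all edges of \<open>z (g z - g 0)\<close>, whose terms are nonnegative by monotonicity.  Hence a
  single term is at most \<open>norm (centering *v \<zeta>)\<close> times a constant.  For the edge \<open>e\<close> of \<open>T\<close> with the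
  largest \<open>\<bar>z $ e\<bar>\<close>, this norm is itself at most a multiple of \<open>\<bar>z $ e\<bar>\<close>; dividing by \<open>\<bar>z $ e\<bar>\<close> bounds
  \<open>g e (z $ e) - g e 0\<close>, and coercivity bounds \<open>z $ e\<close>.
\<close>

lemma potentials_bounded:
  fixes g :: "'m \<Rightarrow> real \<Rightarrow> real" and G :: "real ^ 'm \<Rightarrow> real ^ 'm"
  defines "G \<equiv> \<lambda>z. \<chi> e. g e (z $ e)"
  assumes join: "\<And>i j. joined T i j"
    and mono: "\<And>e. mono (g e)"
    and coercive: "\<And>e R. e \<in> T \<Longrightarrow> \<exists>M\<ge>0. \<forall>z. \<bar>g e z - g e 0\<bar> \<le> R \<longrightarrow> \<bar>z\<bar> \<le> M"
  shows "\<exists>K. \<forall>\<zeta>. norm (Inc *v G (transpose Inc *v \<zeta>)) \<le> R \<longrightarrow> norm (centering *v \<zeta>) \<le> K"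
proof -
  obtain K where "K > 0" and K: "\<And>v :: real ^ 'n. \<And>M. \<forall>e\<in>T. \<bar>v $ src e - v $ tgt e\<bar> \<le> M \<Longrightarrow>
      0 \<le> M \<Longrightarrow> norm (centering *v v) \<le> K * M"
    using centering_bound[OF join] by metis
  define R' where "R' = K * (R + norm (Inc *v G 0))"
  obtain M where M: "\<And>e. e \<in> T \<Longrightarrow> M e \<ge> 0" "\<And>e z. e \<in> T \<Longrightarrow> \<bar>g e z - g e 0\<bar> \<le> R' \<Longrightarrow> \<bar>z\<bar> \<le> M e"
  proof -
    have "\<forall>e. \<exists>M. e \<in> T \<longrightarrow> 0 \<le> M \<and> (\<forall>z. \<bar>g e z - g e 0\<bar> \<le> R' \<longrightarrow> \<bar>z\<bar> \<le> M)"
      using coercive[of _ R'] by blast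
    then show ?thesis using that by metis
  qed
  have "norm (centering *v \<zeta>) \<le> K * (\<Sum>e\<in>T. M e)" if bound: "norm (Inc *v G (transpose Inc *v \<zeta>)) \<le> R" for \<zeta>
  proof (cases "T = {}")
    case True
    then show ?thesis using K[of \<zeta> 0] by simp
  next
    case False
    let ?z = "transpose Inc *v \<zeta>"
    let ?D = "G ?z - G 0"
    obtain e where e: "e \<in> T" "\<And>l. l \<in> T \<Longrightarrow> \<bar>?z $ l\<bar> \<le> \<bar>?z $ e\<bar>"
      using obtains_MAX[OF finite False, of "\<lambda>l. \<bar>?z $ l\<bar>"]
      by (metis (mono_tags, lifting) Max_ge finite finite_imageI imageI)
    have centered: "norm (centering *v \<zeta>) \<le> K * \<bar>?z $ e\<bar>"
      using e(2) by (intro K) (simp_all flip: incidence_transpose_mult)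
    \<comment> \<open>Both factors have the same sign, because each inverse marginal cost is increasing.\<close>
    have sign: "?z $ l * ?D $ l = \<bar>?z $ l\<bar> * \<bar>?D $ l\<bar>" for l
    proof (cases "?z $ l \<ge> 0")
      case True
      then show ?thesis using monoD[OF mono[of l] True] by (simp add: G_def)
    next
      case False
      then have "?D $ l \<le> 0" using monoD[OF mono[of l], of "?z $ l" 0] by (simp add: G_def)
      then show ?thesis using False by (simp add: abs_of_nonpos algebra_simps)
    qed
    have "\<bar>?z $ e\<bar> * \<bar>?D $ e\<bar> \<le> (\<Sum>l\<in>UNIV. \<bar>?z $ l\<bar> * \<bar>?D $ l\<bar>)"
      by (rule member_le_sum) auto
    also have "\<dots> = \<zeta> \<bullet> (Inc *v ?D)"
      unfolding incidence_mult_inner sign[symmetric] by (simp add: incidence_transpose_mult)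
    also have "\<dots> = \<zeta> \<bullet> (centering *v (Inc *v ?D))"
      by (simp add: centering_mult_id ones_inner_incidence)
    also have "\<dots> = (centering *v \<zeta>) \<bullet> (Inc *v ?D)"
      by (subst inner_matrix_vector) (simp add: transpose_centering)
    also have "\<dots> \<le> norm (centering *v \<zeta>) * norm (Inc *v ?D)"
      by (rule norm_cauchy_schwarz)
    also have "\<dots> \<le> (K * \<bar>?z $ e\<bar>) * (R + norm (Inc *v G 0))"
    proof (rule mult_mono[OF centered])
      show "norm (Inc *v ?D) \<le> R + norm (Inc *v G 0)"
        unfolding matrix_vector_mult_diff_distrib
        using norm_triangle_ineq4[of "Inc *v G ?z" "Inc *v G 0"] bound by linarith
    qed (use \<open>K > 0\<close> in auto)
    finally have "\<bar>?z $ e\<bar> * \<bar>?D $ e\<bar> \<le> \<bar>?z $ e\<bar> * R'"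
      by (simp add: R'_def mult_ac)
    then have "\<bar>?z $ e\<bar> \<le> M e"
      using M[OF e(1)] by (cases "?z $ e = 0") (auto simp: G_def)
    also have "M e \<le> (\<Sum>e\<in>T. M e)"
      using e(1) M(1) by (intro member_le_sum) auto
    finally have "K * \<bar>?z $ e\<bar> \<le> K * (\<Sum>e\<in>T. M e)" using \<open>K > 0\<close> by simp
    with centered show ?thesis by linarith
  qed
  then show ?thesis by blast
qed

end

section \<open>Calculus on time intervals\<close>

lemma vec_lambda_has_vector_derivative:
  fixes f :: "real \<Rightarrow> 'm::finite \<Rightarrow> real"
  assumes "\<And>e. ((\<lambda>t. f t e) has_real_derivative f' e) (at t within S)"
  shows "((\<lambda>t. \<chi> e. f t e) has_vector_derivative (\<chi> e. f' e)) (at t within S)"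
proof -
  have expand: "(\<chi> e. c e) = (\<Sum>e\<in>UNIV. c e *\<^sub>R axis e 1)" for c :: "'m \<Rightarrow> real"
    using basis_expansion[of "\<chi> e. c e"] by (simp add: scalar_mult_eq_scaleR)
  show ?thesis
    unfolding expand
    by (intro has_vector_derivative_sum) (use assms in \<open>auto intro!: derivative_eq_intros\<close>)
qed

lemma matrix_mult_has_vector_derivative:
  fixes A :: "real ^ 'b ^ 'a"
  assumes "(f has_vector_derivative f') (at t within S)"
  shows "((\<lambda>t. A *v f t) has_vector_derivative A *v f') (at t within S)"
  using bounded_linear.has_vector_derivative[OF matrix_vector_mul_bounded_linear assms] .

lemma nth_has_real_derivative:
  assumes "(f has_vector_derivative f') (at t within S)"
  shows "((\<lambda>t. f t $ i) has_real_derivative f' $ i) (at t within S)"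
  using bounded_linear.has_vector_derivative[OF bounded_linear_vec_nth assms]
  by (simp add: has_real_derivative_iff_has_vector_derivative)

lemma norm_squared_has_real_derivative:
  fixes f :: "real \<Rightarrow> 'a::real_inner"
  assumes "(f has_vector_derivative f') (at t within S)"
  shows "((\<lambda>t. (norm (f t))\<^sup>2) has_real_derivative 2 * (f t \<bullet> f')) (at t within S)"
proof -
  have "((\<lambda>t. f t \<bullet> f t) has_vector_derivative f t \<bullet> f' + f' \<bullet> f t) (at t within S)"
    by (rule bounded_bilinear.has_vector_derivative[OF bounded_bilinear_inner assms assms])
  then show ?thesis
    by (simp add: has_real_derivative_iff_has_vector_derivative power2_norm_eq_inner inner_commute)
qed

lemma time_interval_nonneg: "t \<in> time_interval \<tau> \<Longrightarrow> 0 \<le> t"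
  by (simp add: time_interval_def)

lemma time_interval_initial_segment: "t \<in> time_interval \<tau> \<Longrightarrow> {0..t} \<subseteq> time_interval \<tau>"
  by (auto simp: time_interval_def) (meson ereal_less_eq(3) le_less_trans)

lemma convex_time_interval: "convex (time_interval \<tau>)"
  unfolding is_interval_convex_1[symmetric] is_interval_1
  by (meson atLeastAtMost_iff order_trans subsetD time_interval_initial_segment time_interval_nonneg)

lemma time_interval_infinity: "time_interval \<infinity> = {0..}"
  by (auto simp: time_interval_def)

lemma gronwall_decay:
  fixes V V' :: "real \<Rightarrow> real"
  assumes deriv: "\<And>t. t \<in> time_interval \<tau> \<Longrightarrow> (V has_real_derivative V' t) (at t within time_interval \<tau>)"
    and decay: "\<And>t. t \<in> time_interval \<tau> \<Longrightarrow> V' t \<le> - c * V t"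
    and t: "t \<in> time_interval \<tau>"
  shows "V t \<le> V 0 * exp (- c * t)"
proof -
  let ?u = "\<lambda>t. V t * exp (c * t)" and ?S = "time_interval \<tau>"
  have du: "(?u has_real_derivative (V' r + c * V r) * exp (c * r)) (at r within ?S)" if "r \<in> ?S" for r
    by (rule derivative_eq_intros deriv[OF that] refl | simp add: algebra_simps)+
  have sub: "{0..t} \<subseteq> ?S" by (rule time_interval_initial_segment[OF t])
  have "?u t \<le> ?u 0"
  proof (rule DERIV_nonpos_imp_decreasing_open[where f = ?u and a = 0 and b = t])
    show "0 \<le> t" using t by (rule time_interval_nonneg)
    show "continuous_on {0..t} ?u"
      by (rule continuous_on_subset[OF DERIV_continuous_on[OF du] sub])
    fix r assume "0 < r" "r < t"
    then have r: "r \<in> {0<..<t}" "r \<in> ?S" using sub by auto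
    have "{0<..<t} \<subseteq> ?S" using sub by auto
    then have "at r within ?S = at r"
      using r(1) by (intro at_within_interior) (metis interior_maximal open_greaterThanLessThan subsetD)
    then have "(?u has_real_derivative (V' r + c * V r) * exp (c * r)) (at r)"
      using du[OF r(2)] by simp
    moreover have "(V' r + c * V r) * exp (c * r) \<le> 0"
      using decay[OF r(2)] by (simp add: mult_le_0_iff)
    ultimately show "\<exists>y. (?u has_real_derivative y) (at r) \<and> y \<le> 0" by blast
  qed
  then show ?thesis by (simp add: exp_minus field_simps)
qed

text \<open>
  A centred derivative leaves the mean of \<open>x\<close> unchanged.
\<close>

lemma bounded_if_centered_bounded:
  fixes x :: "real \<Rightarrow> real ^ 'n"
  assumes S: "convex S"
    and deriv: "\<And>t. t \<in> S \<Longrightarrow> (x has_vector_derivative x' t) (at t within S)"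
    and centered: "\<And>t. t \<in> S \<Longrightarrow> centering *v x' t = x' t"
    and bound: "\<And>t. t \<in> S \<Longrightarrow> norm (centering *v x t) \<le> R"
  shows "bounded (x ` S)"
proof -
  have "((\<lambda>t. x t - centering *v x t) has_vector_derivative 0) (at t within S)" if "t \<in> S" for t
    using has_vector_derivative_diff[OF deriv[OF that] matrix_mult_has_vector_derivative[OF deriv[OF that], of centering]]
    by (simp add: centered[OF that])
  then obtain a where a: "\<And>t. t \<in> S \<Longrightarrow> x t - centering *v x t = a"
    using has_vector_derivative_zero_constant[OF S] by blast
  have "norm (x t) \<le> norm a + R" if "t \<in> S" for t
  proof -
    have "x t = a + centering *v x t" using a[OF that] by (simp add: algebra_simps)
    then show ?thesis using norm_triangle_ineq[of a "centering *v x t"] bound[OF that] by simp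
  qed
  then show ?thesis by (auto intro: boundedI)
qed

section \<open>The closed loop\<close>

lemma matrix_vector_mult_uminus: "A *v (- x) = - (A *v x)" for A :: "real ^ 'b ^ 'a"
  using matrix_vector_mult_diff_distrib[of A 0 x] by simp

lemma at_within_halfline_neq_bot: "at t within {0::real..} \<noteq> bot" if "t \<ge> 0"
proof -
  have "at_right t \<le> at t within {0..}" using that by (intro at_le) auto
  then show ?thesis using trivial_limit_at_right_real[of t] by (auto simp: bot_unique)
qed

text \<open>
  The hypotheses on network, exo-system and costs, shared by the analysis of the closed loop.
\<close>

locale distribution_network = network src tgt
  for src tgt :: "'m::finite \<Rightarrow> 'n::finite" +
  fixes P :: "real ^ 'r ^ 'n" and s :: "real ^ 'r \<Rightarrow> real ^ 'r" and w :: "real \<Rightarrow> real ^ 'r"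
    and W :: "(real ^ 'r) set" and cap :: "'m \<Rightarrow> ereal" and cost :: "'m \<Rightarrow> real \<Rightarrow> ereal"
    and k :: real
  assumes cap_pos: "0 < cap e"
    and exo: "exo_solution s w"
    and compact_W: "compact W" and invariant_W: "forward_invariant s W" and start_W: "w 0 \<in> W"
    and balanced: "t \<ge> 0 \<Longrightarrow> (\<chi> i. 1) \<bullet> (P *v w t) = 0"
    and legendre: "legendre_type (cap e) (cost e)"
    and cut_infinite: "S \<noteq> {} \<Longrightarrow> S \<subset> UNIV \<Longrightarrow> cut_capacity src tgt cap S = \<infinity>"
    and gain: "k > 0"
begin

abbreviation g :: "'m \<Rightarrow> real \<Rightarrow> real" where
  "g e \<equiv> marginal_cost_inv (cap e) (cost e)"

abbreviation flow :: "real ^ 'n \<Rightarrow> real ^ 'm" where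
  "flow \<zeta> \<equiv> grad_cost_inv cap cost (transpose Inc *v \<zeta>)"

text \<open>
  The net inflow of the nodes under the flow that the potentials \<open>\<zeta>\<close> prescribe; it vanishes iff this
  flow meets the demand \<open>v\<close>, and the closed loop drives it to zero.
\<close>

definition imbalance :: "real ^ 'n \<Rightarrow> real ^ 'r \<Rightarrow> real ^ 'n" where
  "imbalance \<zeta> v = Inc *v flow \<zeta> + P *v v"

definition controller :: "real ^ 'n \<Rightarrow> real ^ 'r \<Rightarrow> real ^ 'n \<Rightarrow> real ^ 'n" where
  "controller \<zeta> v x = - (centering *v (Xi_matrix src tgt cap cost \<zeta> *v
     (P *v s v + x + k *\<^sub>R imbalance \<zeta> v)))"

definition routing :: "real ^ 'n \<Rightarrow> real ^ 'n \<Rightarrow> real ^ 'm" where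
  "routing \<zeta> x = flow \<zeta> - transpose Inc *v x"

abbreviation trajectory :: "ereal \<Rightarrow> (real \<Rightarrow> real ^ 'n) \<Rightarrow> (real \<Rightarrow> real ^ 'n) \<Rightarrow> bool" where
  "trajectory \<equiv> closed_loop_trajectory Inc P w controller routing"

sublocale edge: legendre_cost "cap e" "cost e" for e
  using legendre cap_pos by unfold_locales

text \<open>
  An infinite sum of capacities has an infinite term, so every cut contains an uncapacitated edge.
\<close>

lemma joined_by_uncapacitated_edges: "joined {e. cap e = \<infinity>} i j"
proof (rule joined_if_cuts_meet)
  fix S :: "'n set"
  assume "S \<noteq> {}" "S \<subset> UNIV"
  then show "\<exists>e\<in>{e. cap e = \<infinity>}. e \<in> cut src tgt S"
    using cut_infinite[of S] by (auto simp: cut_capacity_def sum_Pinfty)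
qed

lemma joined_all: "joined UNIV i j"
  by (rule joined_mono[OF joined_by_uncapacitated_edges]) simp

lemma exo_deriv: "t \<ge> 0 \<Longrightarrow> (w has_vector_derivative s (w t)) (at t within {0..})"
  using exo by (simp add: exo_solution_def)

lemma w_in_W: "t \<ge> 0 \<Longrightarrow> w t \<in> W"
  using exo invariant_W start_W unfolding forward_invariant_def by blast

lemma balanced_rate:
  assumes "t \<ge> 0"
  shows "(\<chi> i. 1) \<bullet> (P *v s (w t)) = 0"
proof -
  have "((\<lambda>t. (\<chi> i. 1) \<bullet> (P *v w t)) has_vector_derivative (\<chi> i. 1) \<bullet> (P *v s (w t))) (at t within {0..})"
    by (intro bounded_linear.has_vector_derivative[OF bounded_linear_inner_right]
        matrix_mult_has_vector_derivative exo_deriv assms)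
  moreover have "((\<lambda>t. (\<chi> i. 1) \<bullet> (P *v w t)) has_vector_derivative 0) (at t within {0..})"
    by (rule has_vector_derivative_transform[where f = "\<lambda>_. 0"]) (use assms balanced in auto)
  ultimately show ?thesis
    using vector_derivative_unique_within[OF at_within_halfline_neq_bot[OF assms]] by blast
qed

lemma centering_imbalance:
  assumes "t \<ge> 0"
  shows "centering *v imbalance \<zeta> (w t) = imbalance \<zeta> (w t)"
  unfolding imbalance_def
  by (rule centering_mult_id) (simp add: inner_add_right ones_inner_incidence balanced[OF assms])

lemma H_matrix_mult: "(H_matrix src tgt cap cost \<zeta> *v z) $ e = deriv (g e) ((transpose Inc *v \<zeta>) $ e) * z $ e"
proof -
  have "(H_matrix src tgt cap cost \<zeta> *v z) $ e =
      (\<Sum>l\<in>UNIV. if l = e then deriv (g e) ((transpose Inc *v \<zeta>) $ e) * z $ e else 0)"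
    unfolding matrix_vector_mult_def H_matrix_def D_grad_cost_inv_def vec_lambda_beta
    by (intro sum.cong) auto
  then show ?thesis by simp
qed

lemma flow_deriv:
  assumes "(\<zeta> has_vector_derivative \<zeta>') (at t within S)"
  shows "((\<lambda>t. flow (\<zeta> t)) has_vector_derivative
    H_matrix src tgt cap cost (\<zeta> t) *v (transpose Inc *v \<zeta>')) (at t within S)"
proof -
  have "((\<lambda>t. \<chi> e. g e ((transpose Inc *v \<zeta> t) $ e)) has_vector_derivative
      (\<chi> e. deriv (g e) ((transpose Inc *v \<zeta> t) $ e) * (transpose Inc *v \<zeta>') $ e)) (at t within S)"
    by (intro vec_lambda_has_vector_derivative DERIV_chain2[OF edge.inverse_deriv]
        nth_has_real_derivative matrix_mult_has_vector_derivative assms)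
  also have "(\<chi> e. deriv (g e) ((transpose Inc *v \<zeta> t) $ e) * (transpose Inc *v \<zeta>') $ e)
      = H_matrix src tgt cap cost (\<zeta> t) *v (transpose Inc *v \<zeta>')"
    by (simp add: vec_eq_iff H_matrix_mult)
  finally show ?thesis by (simp add: grad_cost_inv_def)
qed

lemma time_interval_halfline: "time_interval \<tau> \<subseteq> {0..}"
  using time_interval_nonneg by auto

text \<open>
  The purpose of \<open>\<Xi>\<close>: it cancels the state-dependent weighted Laplacian which the chain rule
  produces, and the feed-forward term cancels the drift of the demand, so that the imbalance obeys
  a linear equation with constant coefficients.
\<close>

lemma imbalance_deriv:
  assumes traj: "trajectory \<tau> x \<zeta>" and t: "t \<in> time_interval \<tau>"
  shows "((\<lambda>t. imbalance (\<zeta> t) (w t)) has_vector_derivative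
    - (centering *v x t) - k *\<^sub>R imbalance (\<zeta> t) (w t)) (at t within time_interval \<tau>)"
proof -
  let ?y = "imbalance (\<zeta> t) (w t)"
  let ?u = "P *v s (w t) + x t + k *\<^sub>R ?y" and ?H = "H_matrix src tgt cap cost (\<zeta> t)"
  have t0: "t \<ge> 0" using t by (rule time_interval_nonneg)
  have "(w has_vector_derivative s (w t)) (at t within time_interval \<tau>)"
    by (rule has_vector_derivative_within_subset[OF exo_deriv[OF t0] time_interval_halfline])
  moreover have "(\<zeta> has_vector_derivative controller (\<zeta> t) (w t) (x t)) (at t within time_interval \<tau>)"
    using traj t unfolding closed_loop_trajectory_def by blast
  ultimately have "((\<lambda>t. imbalance (\<zeta> t) (w t)) has_vector_derivative
      Inc *v (?H *v (transpose Inc *v controller (\<zeta> t) (w t) (x t))) + P *v s (w t)) (at t within time_interval \<tau>)"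
    unfolding imbalance_def
    by (intro has_vector_derivative_add matrix_mult_has_vector_derivative flow_deriv)
  also have "Inc *v (?H *v (transpose Inc *v controller (\<zeta> t) (w t) (x t)))
      = - (Inc *v (?H *v (transpose Inc *v (Xi_matrix src tgt cap cost (\<zeta> t) *v ?u))))"
    by (simp add: controller_def matrix_vector_mult_uminus transpose_incidence_centering)
  also have "\<dots> = - (centering *v ?u)"
    by (simp add: Xi_matrix_inverts[OF joined_all edge.inverse_deriv_pos])
  also have "centering *v ?u = P *v s (w t) + centering *v x t + k *\<^sub>R ?y"
    by (simp add: matrix_vector_right_distrib matrix_vector_mult_scaleR
        centering_mult_id[OF balanced_rate[OF t0]] centering_imbalance[OF t0])
  finally show ?thesis by (simp add: algebra_simps)
qed

lemma inventory_deriv: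
  assumes traj: "trajectory \<tau> x \<zeta>" and t: "t \<in> time_interval \<tau>"
  shows "(x has_vector_derivative imbalance (\<zeta> t) (w t) - Inc *v (transpose Inc *v x t)) (at t within time_interval \<tau>)"
    and "centering *v (imbalance (\<zeta> t) (w t) - Inc *v (transpose Inc *v x t)) =
      imbalance (\<zeta> t) (w t) - Inc *v (transpose Inc *v x t)"
proof -
  have "(x has_vector_derivative Inc *v routing (\<zeta> t) (x t) + P *v w t) (at t within time_interval \<tau>)"
    using traj t unfolding closed_loop_trajectory_def by blast
  then show "(x has_vector_derivative imbalance (\<zeta> t) (w t) - Inc *v (transpose Inc *v x t)) (at t within time_interval \<tau>)"
    by (simp add: routing_def imbalance_def matrix_vector_mult_diff_distrib algebra_simps)
  show "centering *v (imbalance (\<zeta> t) (w t) - Inc *v (transpose Inc *v x t)) =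
      imbalance (\<zeta> t) (w t) - Inc *v (transpose Inc *v x t)"
    using time_interval_nonneg[OF t]
    by (simp add: matrix_vector_mult_diff_distrib centering_imbalance centering_mult_id ones_inner_incidence)
qed

definition energy :: "real ^ 'n \<Rightarrow> real ^ 'n \<Rightarrow> real ^ 'r \<Rightarrow> real" where
  "energy x \<zeta> v = (norm (centering *v x))\<^sup>2 + (norm (imbalance \<zeta> v))\<^sup>2"

text \<open>
  The terms coupling inventories and imbalance cancel.  What is left is dissipation by the Laplacian
  and by the gain \<open>k\<close>, which the Poincare inequality bounds below by a multiple of the energy.
\<close>

lemma energy_decay:
  "\<exists>c>0. \<forall>\<tau> x \<zeta> t. trajectory \<tau> x \<zeta> \<longrightarrow> t \<in> time_interval \<tau> \<longrightarrow>
     energy (x t) (\<zeta> t) (w t) \<le> energy (x 0) (\<zeta> 0) (w 0) * exp (- c * t)"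
proof -
  obtain K where "K > 0" and K: "\<And>v. norm (centering *v v) \<le> K * norm (transpose Inc *v v)"
    using poincare_inequality[OF joined_all] by blast
  \<comment> \<open>The slower of the two dissipation rates, of the inventories and of the imbalance.\<close>
  define c where "c = min (2 / K\<^sup>2) (2 * k)"
  have "c > 0" using \<open>K > 0\<close> gain by (simp add: c_def)
  have "energy (x t) (\<zeta> t) (w t) \<le> energy (x 0) (\<zeta> 0) (w 0) * exp (- c * t)"
    if traj: "trajectory \<tau> x \<zeta>" and t: "t \<in> time_interval \<tau>" for \<tau> x \<zeta> t
  proof (rule gronwall_decay[OF _ _ t])
    fix t assume t: "t \<in> time_interval \<tau>"
    let ?y = "imbalance (\<zeta> t) (w t)" and ?p = "centering *v x t"
    let ?V' = "- 2 * (norm (transpose Inc *v x t))\<^sup>2 - 2 * k * (norm ?y)\<^sup>2"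
    have "((\<lambda>t. energy (x t) (\<zeta> t) (w t)) has_real_derivative
        2 * (?p \<bullet> (centering *v (?y - Inc *v (transpose Inc *v x t)))) +
        2 * (?y \<bullet> (- ?p - k *\<^sub>R ?y))) (at t within time_interval \<tau>)"
      unfolding energy_def
      by (intro DERIV_add norm_squared_has_real_derivative matrix_mult_has_vector_derivative
          inventory_deriv[OF traj t] imbalance_deriv[OF traj t])
    also have "2 * (?p \<bullet> (centering *v (?y - Inc *v (transpose Inc *v x t)))) + 2 * (?y \<bullet> (- ?p - k *\<^sub>R ?y)) = ?V'"
    proof -
      have "?p \<bullet> (Inc *v (transpose Inc *v x t)) = (norm (transpose Inc *v x t))\<^sup>2"
        by (subst inner_matrix_vector) (simp add: transpose_incidence_centering power2_norm_eq_inner)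
      then show ?thesis
        unfolding inventory_deriv(2)[OF traj t]
        by (simp add: inner_diff_right power2_norm_eq_inner[of ?y] inner_commute[of ?y ?p] right_diff_distrib)
    qed
    finally show "((\<lambda>t. energy (x t) (\<zeta> t) (w t)) has_real_derivative ?V') (at t within time_interval \<tau>)" .
    have "c * (norm ?p)\<^sup>2 \<le> (2 / K\<^sup>2) * (K * norm (transpose Inc *v x t))\<^sup>2"
      using K[of "x t"] \<open>c > 0\<close> by (intro mult_mono power_mono) (auto simp: c_def)
    also have "\<dots> = 2 * (norm (transpose Inc *v x t))\<^sup>2"
      using \<open>K > 0\<close> by (simp add: power_mult_distrib)
    finally have "c * (norm ?p)\<^sup>2 \<le> 2 * (norm (transpose Inc *v x t))\<^sup>2" .
    moreover have "c * (norm ?y)\<^sup>2 \<le> 2 * k * (norm ?y)\<^sup>2"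
      by (intro mult_right_mono) (auto simp: c_def)
    ultimately show "?V' \<le> - c * energy (x t) (\<zeta> t) (w t)"
      unfolding energy_def by (simp add: algebra_simps)
  qed
  with \<open>c > 0\<close> show ?thesis by blast
qed

lemma bounded_energy:
  assumes traj: "trajectory \<tau> x \<zeta>"
  shows "\<exists>R. \<forall>t\<in>time_interval \<tau>. norm (centering *v x t) \<le> R \<and> norm (imbalance (\<zeta> t) (w t)) \<le> R"
proof -
  let ?R = "sqrt (energy (x 0) (\<zeta> 0) (w 0))"
  have "norm (centering *v x t) \<le> ?R \<and> norm (imbalance (\<zeta> t) (w t)) \<le> ?R" if t: "t \<in> time_interval \<tau>" for t
  proof -
    obtain c where "c > 0" and c: "energy (x t) (\<zeta> t) (w t) \<le> energy (x 0) (\<zeta> 0) (w 0) * exp (- c * t)"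
      using energy_decay traj t by blast
    have "exp (- c * t) \<le> 1" using \<open>c > 0\<close> time_interval_nonneg[OF t] by simp
    then have "energy (x t) (\<zeta> t) (w t) \<le> energy (x 0) (\<zeta> 0) (w 0)"
      using c mult_left_mono[of "exp (- c * t)" 1 "energy (x 0) (\<zeta> 0) (w 0)"] by (simp add: energy_def)
    then have "(norm (centering *v x t))\<^sup>2 \<le> energy (x 0) (\<zeta> 0) (w 0)"
      "(norm (imbalance (\<zeta> t) (w t)))\<^sup>2 \<le> energy (x 0) (\<zeta> 0) (w 0)"
      unfolding energy_def[of "x t"] by (smt (verit) zero_le_power2)+
    then show ?thesis by (simp add: real_le_rsqrt)
  qed
  then show ?thesis by blast
qed

lemma bounded_supply: "bounded (w ` {0..})"
  by (rule bounded_subset[OF compact_imp_bounded[OF compact_W]]) (use w_in_W in auto)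

text \<open>
  The imbalance and the demand are bounded, so the outflow of the prescribed flow is.
\<close>

lemma bounded_centered_potential:
  assumes traj: "trajectory \<tau> x \<zeta>"
  shows "\<exists>R. \<forall>t\<in>time_interval \<tau>. norm (centering *v \<zeta> t) \<le> R"
proof -
  obtain R where R: "\<And>t. t \<in> time_interval \<tau> \<Longrightarrow> norm (imbalance (\<zeta> t) (w t)) \<le> R"
    using bounded_energy[OF traj] by blast
  have "bounded ((*v) P ` w ` {0..})"
    by (intro bounded_linear_image bounded_supply matrix_vector_mul_bounded_linear)
  then obtain Q where Q: "\<And>t. t \<ge> 0 \<Longrightarrow> norm (P *v w t) \<le> Q"
    unfolding bounded_iff by auto
  have "norm (Inc *v flow (\<zeta> t)) \<le> R + Q" if t: "t \<in> time_interval \<tau>" for t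
  proof -
    have "Inc *v flow (\<zeta> t) = imbalance (\<zeta> t) (w t) - P *v w t" by (simp add: imbalance_def)
    then show ?thesis
      using norm_triangle_ineq4[of "imbalance (\<zeta> t) (w t)" "P *v w t"] R[OF t] Q[OF time_interval_nonneg[OF t]]
      by simp
  qed
  moreover have "\<exists>K. \<forall>\<zeta>. norm (Inc *v flow \<zeta>) \<le> R + Q \<longrightarrow> norm (centering *v \<zeta>) \<le> K"
    unfolding grad_cost_inv_def
  proof (rule potentials_bounded[OF joined_by_uncapacitated_edges])
    show "mono (g e)" for e by (rule strict_mono_mono[OF edge.inverse_strict_mono])
    show "\<exists>M\<ge>0. \<forall>z. \<bar>g e z - g e 0\<bar> \<le> R' \<longrightarrow> \<bar>z\<bar> \<le> M" if "e \<in> {e. cap e = \<infinity>}" for e R'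
      using that by (intro edge.inverse_coercive) simp
  qed
  ultimately show ?thesis by blast
qed

lemma trajectory_bounded:
  assumes traj: "trajectory \<tau> x \<zeta>"
  shows "bounded (x ` time_interval \<tau>)" "bounded (w ` time_interval \<tau>)" "bounded (\<zeta> ` time_interval \<tau>)"
proof -
  obtain R where R: "\<And>t. t \<in> time_interval \<tau> \<Longrightarrow> norm (centering *v x t) \<le> R"
    using bounded_energy[OF traj] by blast
  show "bounded (x ` time_interval \<tau>)"
    by (rule bounded_if_centered_bounded[OF convex_time_interval inventory_deriv(1)[OF traj]
        inventory_deriv(2)[OF traj] R])
  show "bounded (w ` time_interval \<tau>)"
    by (rule bounded_subset[OF bounded_supply image_mono[OF time_interval_halfline]])
  obtain R' where R': "\<And>t. t \<in> time_interval \<tau> \<Longrightarrow> norm (centering *v \<zeta> t) \<le> R'"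
    using bounded_centered_potential[OF traj] by blast
  show "bounded (\<zeta> ` time_interval \<tau>)"
  proof (rule bounded_if_centered_bounded[OF convex_time_interval _ _ R'])
    show "(\<zeta> has_vector_derivative controller (\<zeta> t) (w t) (x t)) (at t within time_interval \<tau>)"
      if "t \<in> time_interval \<tau>" for t
      using traj that unfolding closed_loop_trajectory_def by blast
    show "centering *v controller (\<zeta> t) (w t) (x t) = controller (\<zeta> t) (w t) (x t)" for t
      by (simp add: controller_def matrix_vector_mult_uminus centering_idem)
  qed
qed

lemma energy_vanishes:
  assumes traj: "trajectory \<infinity> x \<zeta>"
  shows "((\<lambda>t. centering *v x t) \<longlongrightarrow> 0) at_top" "((\<lambda>t. imbalance (\<zeta> t) (w t)) \<longlongrightarrow> 0) at_top"
proof -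
  obtain c where "c > 0" and c: "\<And>t. t \<ge> 0 \<Longrightarrow>
      energy (x t) (\<zeta> t) (w t) \<le> energy (x 0) (\<zeta> 0) (w 0) * exp (- c * t)"
    using energy_decay traj by (auto simp: time_interval_infinity)
  have "((\<lambda>t. exp (- c * t)) \<longlongrightarrow> 0) at_top"
    using \<open>c > 0\<close> by (intro filterlim_compose[OF exp_at_bot] filterlim_tendsto_neg_mult_at_bot[of _ "- c"] filterlim_ident)
      auto
  then have lim: "((\<lambda>t. energy (x 0) (\<zeta> 0) (w 0) * exp (- c * t)) \<longlongrightarrow> 0) at_top"
    using tendsto_mult_right_zero by blast
  have vanish: "(f \<longlongrightarrow> 0) at_top"
    if "\<And>t. t \<ge> 0 \<Longrightarrow> (norm (f t))\<^sup>2 \<le> energy (x t) (\<zeta> t) (w t)" for f :: "real \<Rightarrow> real ^ 'n"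
  proof -
    have "((\<lambda>t. (norm (f t))\<^sup>2) \<longlongrightarrow> 0) at_top"
    proof (rule tendsto_sandwich[OF _ _ tendsto_const lim])
      show "\<forall>\<^sub>F t in at_top. (norm (f t))\<^sup>2 \<le> energy (x 0) (\<zeta> 0) (w 0) * exp (- c * t)"
        using eventually_ge_at_top[of 0] by eventually_elim (use that c in fastforce)
    qed simp
    then have "((\<lambda>t. sqrt ((norm (f t))\<^sup>2)) \<longlongrightarrow> sqrt 0) at_top" by (rule tendsto_real_sqrt)
    then show ?thesis by (simp add: tendsto_norm_zero_iff)
  qed
  show "((\<lambda>t. centering *v x t) \<longlongrightarrow> 0) at_top" "((\<lambda>t. imbalance (\<zeta> t) (w t)) \<longlongrightarrow> 0) at_top"
    by (rule vanish, simp add: energy_def)+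
qed

lemma inventories_balance:
  assumes traj: "trajectory \<infinity> x \<zeta>"
  shows "((\<lambda>t. transpose Inc *v x t) \<longlongrightarrow> 0) at_top"
  using bounded_linear.tendsto_zero[OF matrix_vector_mul_bounded_linear energy_vanishes(1)[OF traj], of "transpose Inc"]
  by (simp add: transpose_incidence_centering)

lemma flow_tendsto:
  assumes "(\<zeta> \<longlongrightarrow> l) F"
  shows "((\<lambda>t. flow (\<zeta> t)) \<longlongrightarrow> flow l) F"
  unfolding grad_cost_inv_def
proof (intro tendsto_vec_lambda)
  fix e
  have "isCont (g e) z" for z by (rule DERIV_isCont[OF edge.inverse_deriv])
  then show "((\<lambda>t. g e ((transpose Inc *v \<zeta> t) $ e)) \<longlongrightarrow> g e ((transpose Inc *v l) $ e)) F"
    by (intro isCont_tendsto_compose[of _ "g e"] tendsto_vec_nth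
        bounded_linear.tendsto[OF matrix_vector_mul_bounded_linear] assms)
qed

text \<open>
  By construction the prescribed flow respects the capacities and has the marginal costs \<open>B\<^sup>T \<zeta>\<close>, so
  it is optimal as soon as it is balanced.
\<close>

lemma flow_optimal:
  assumes "v \<in> W" and "imbalance \<zeta> v = 0"
  shows "(flow \<zeta>, v) \<in> optimal_routing_set Inc P W cap cost"
proof -
  have "grad_cost cost (flow \<zeta>) = transpose Inc *v \<zeta>"
    by (simp add: grad_cost_def grad_cost_inv_def edge.marginal_cost_inverse)
  then show ?thesis
    using assms unfolding optimal_routing_set_def imbalance_def
    by (auto simp: grad_cost_inv_def edge.inverse_in_interval)
qed

text \<open>
  Along times at which the distance stays at least \<open>a\<close>, the centred potentials and the demand
  accumulate at some \<open>(z, v)\<close> with \<open>v \<in> W\<close>.  Its imbalance is a limit of vanishing imbalances, so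
  \<open>(flow z, v)\<close> is an optimal pair, which the routing approaches: a contradiction.
\<close>

lemma routing_converges:
  assumes traj: "trajectory \<infinity> x \<zeta>"
  shows "((\<lambda>t. dist_to (optimal_routing_set Inc P W cap cost) (routing (\<zeta> t) (x t), w t)) \<longlongrightarrow> 0) at_top"
proof (rule order_tendstoI)
  let ?d = "\<lambda>t. dist_to (optimal_routing_set Inc P W cap cost) (routing (\<zeta> t) (x t), w t)"
  have "?d t \<ge> 0" for t unfolding dist_to_def by (intro INF_greatest) simp
  then show "\<forall>\<^sub>F t in at_top. a < ?d t" if "a < 0" for a
    using that by (intro always_eventually allI less_le_trans[OF that])
  show "\<forall>\<^sub>F t in at_top. ?d t < a" if "0 < a" for a
  proof (rule ccontr)
    assume "\<not> ?thesis"
    then have "\<exists>t\<ge>real n. a \<le> ?d t" for n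
      unfolding eventually_at_top_linorder by (meson not_less)
    then obtain r where r: "\<And>n. r n \<ge> real n" "\<And>n. a \<le> ?d (r n)" by metis
    have r0: "r n \<ge> 0" for n using r(1)[of n] by (meson of_nat_0_le_iff order_trans)
    have r_top: "filterlim r at_top sequentially"
      by (rule filterlim_at_top_mono[OF filterlim_real_sequentially]) (use r(1) in auto)
    obtain R where R: "\<And>t. t \<ge> 0 \<Longrightarrow> norm (centering *v \<zeta> t) \<le> R"
      using bounded_centered_potential[OF traj] by (auto simp: time_interval_infinity)
    have "seq_compact (cball (0 :: real ^ 'n) R \<times> W)"
      by (intro compact_imp_seq_compact compact_Times compact_cball compact_W)
    moreover have "\<forall>n. (centering *v \<zeta> (r n), w (r n)) \<in> cball 0 R \<times> W"
      using R r0 w_in_W by simp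
    ultimately obtain q \<sigma> where q: "q \<in> cball 0 R \<times> W" "strict_mono \<sigma>"
      "((\<lambda>n. (centering *v \<zeta> (r n), w (r n))) \<circ> \<sigma>) \<longlonglongrightarrow> q"
      by (rule seq_compactE)
    obtain z v where zv: "q = (z, v)" "v \<in> W" using q(1) by auto
    have lim: "(\<lambda>n. centering *v \<zeta> (r (\<sigma> n))) \<longlonglongrightarrow> z" "(\<lambda>n. w (r (\<sigma> n))) \<longlonglongrightarrow> v"
      using tendsto_fst[OF q(3)] tendsto_snd[OF q(3)] by (simp_all add: zv(1) o_def)
    have r\<sigma>: "filterlim (\<lambda>n. r (\<sigma> n)) at_top sequentially"
      by (rule filterlim_compose[OF r_top filterlim_subseq[OF q(2)]])
    have flow_lim: "(\<lambda>n. flow (\<zeta> (r (\<sigma> n)))) \<longlonglongrightarrow> flow z"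
      using flow_tendsto[OF lim(1)] by (simp add: transpose_incidence_centering)
    have "(\<lambda>n. imbalance (\<zeta> (r (\<sigma> n))) (w (r (\<sigma> n)))) \<longlonglongrightarrow> imbalance z v"
      unfolding imbalance_def
      by (intro tendsto_add bounded_linear.tendsto[OF matrix_vector_mul_bounded_linear] flow_lim lim(2))
    moreover have "(\<lambda>n. imbalance (\<zeta> (r (\<sigma> n))) (w (r (\<sigma> n)))) \<longlonglongrightarrow> 0"
      by (rule filterlim_compose[OF energy_vanishes(2)[OF traj] r\<sigma>])
    ultimately have "imbalance z v = 0" by (rule LIMSEQ_unique)
    then have opt: "(flow z, v) \<in> optimal_routing_set Inc P W cap cost"
      using zv(2) by (intro flow_optimal)
    let ?gap = "\<lambda>n. norm ((flow z, v) - (routing (\<zeta> (r (\<sigma> n))) (x (r (\<sigma> n))), w (r (\<sigma> n))))"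
    have "(\<lambda>n. routing (\<zeta> (r (\<sigma> n))) (x (r (\<sigma> n)))) \<longlonglongrightarrow> flow z - 0"
      unfolding routing_def
      by (intro tendsto_diff flow_lim filterlim_compose[OF inventories_balance[OF traj] r\<sigma>])
    then have "(\<lambda>n. (flow z, v) - (routing (\<zeta> (r (\<sigma> n))) (x (r (\<sigma> n))), w (r (\<sigma> n)))) \<longlonglongrightarrow> (flow z, v) - (flow z, v)"
      by (intro tendsto_diff tendsto_const tendsto_Pair lim(2)) simp
    then have "?gap \<longlonglongrightarrow> 0" using tendsto_norm_zero by fastforce
    then have "(\<lambda>n. ereal (?gap n)) \<longlonglongrightarrow> 0" by (simp add: zero_ereal_def)
    then have "\<forall>\<^sub>F n in sequentially. ereal (?gap n) < a"
      using \<open>0 < a\<close> by (rule order_tendstoD)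
    then obtain n where "ereal (?gap n) < a"
      using eventually_happens'[OF sequentially_bot] by blast
    moreover have "?d (r (\<sigma> n)) \<le> ereal (?gap n)"
      unfolding dist_to_def by (rule INF_lower[OF opt])
    ultimately show False using r(2)[of "\<sigma> n"] by simp
  qed
qed

lemma controller_solves:
  "solves_distribution_problem Inc P (optimal_routing_set Inc P W cap cost) w controller routing"
  unfolding solves_distribution_problem_def
  using trajectory_bounded inventories_balance routing_converges by blast

end

theorem theorem1:
  fixes src tgt :: "'m::finite \<Rightarrow> 'n::finite"
    and B :: "real ^ 'm ^ 'n"
    and P :: "real ^ 'r ^ 'n"
    and s :: "real ^ 'r \<Rightarrow> real ^ 'r"
    and w :: "real \<Rightarrow> real ^ 'r"
    and W :: "(real ^ 'r) set"
    and cap :: "'m \<Rightarrow> ereal"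
    and cost :: "'m \<Rightarrow> real \<Rightarrow> ereal"
    and k :: real
  assumes no_loops: "\<And>e. src e \<noteq> tgt e"
    and B: "B = incidence src tgt"
    and cap_pos: "\<And>e. 0 < cap e"
    and exo: "exo_solution s w"
    and A1: "compact W" "forward_invariant s W" "w 0 \<in> W"
    and A2: "\<And>t. t \<ge> 0 \<Longrightarrow> (\<chi> i. 1) \<bullet> (P *v w t) = 0"
    and A4: "\<And>e. legendre_type (cap e) (cost e)"
    and A5: "\<And>S. S \<noteq> {} \<Longrightarrow> S \<subset> UNIV \<Longrightarrow> cut_capacity src tgt cap S = \<infinity>"
    and gain: "k > 0"
  shows "solves_distribution_problem B P (optimal_routing_set B P W cap cost) w
    (\<lambda>\<zeta> v x. - (centering *v (Xi_matrix src tgt cap cost \<zeta> *v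
        (P *v s v + x + k *\<^sub>R (B *v grad_cost_inv cap cost (transpose B *v \<zeta>) + P *v v)))))
    (\<lambda>\<zeta> x. grad_cost_inv cap cost (transpose B *v \<zeta>) - transpose B *v x)"
proof -
  interpret distribution_network src tgt P s w W cap cost k
    using assms by unfold_locales
  show ?thesis
    using controller_solves
    unfolding B controller_def[abs_def] routing_def[abs_def] imbalance_def .
qed

end
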